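(* Let $M$ be a manifold. The assignment $\mathcal H\mapsto\nabla$, sending a (possibly nonlinear) connection $\mathcal H$ on $TM$ to its associated (possibly nonlinear) covariant derivative $\nabla$, is a bijective correspondence between the set of (possibly nonlinear) connections on $TM$ and the set of (possibly nonlinear) covariant derivatives on $TM$ (the operators associated to connections as defined in the context).
   Context: $M$ is a smooth, finite-dimensional, Hausdorff, paracompact, connected manifold; all objects are smooth. $\pi:TM\to M$ is the projection; $\pi_T:TTM\to TM$ is the usual tangent bundle projection and $\pi_*:TTM\to TM$ the tangent map of $\pi$. The vertical bundle is $\mathcal V=\ker\pi_*$. A connection is a smooth subbundle $\mathcal H$ of $\pi_T:TTM\to TM$ with $TTM=\mathcal H\oplus\mathcal V$; no linearity or homogeneity is assumed. $H$ denotes the projection of $TTM$ onto $\mathcal H$ along $\mathcal V$, with $H_v:T_vTM\to\mathcal H_v$. $K:\mathcal V\to TM$ is the canonical map which on $\mathcal V_v=T_v(T_pM)$, $v\in T_pM$, is the canonical identification of $T_v(T_pM)$ with $T_pM$. The connector of $\mathcal H$ is $\kappa:TTM\to TM$, $\kappa(z)=K(z-H_vz)$ for $z\in T_vTM$. The covariant derivative associated to $\mathcal H$ is the operator on pairs of vector fields $U,V$ on $M$ given by $$\nabla_UV=\kappa(V_*U)=K(V_*U-H_VV_*U),$$ where $V_*$ is the tangent map of $V:M\to TM$. It is tensorial in $U$ but in general nonlinear in $V$. A "(possibly nonlinear) covariant derivative on $TM$" means an operator arising in this way from some connection. *)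

theory Defs
  imports "HOL-Analysis.Analysis" "HOL-Library.Function_Algebras"
begin

subsection \<open>Pointwise vector space structure on functions\<close>

instantiation "fun" :: (type, real_vector) real_vector
begin

definition scaleR_fun :: "real \<Rightarrow> ('a \<Rightarrow> 'b) \<Rightarrow> 'a \<Rightarrow> 'b" where
  "scaleR_fun r f = (\<lambda>x. r *\<^sub>R f x)"

instance
  by standard (auto simp: scaleR_fun_def fun_eq_iff scaleR_add_right scaleR_add_left)

end

lemma scaleR_fun_apply [simp]: "(r *\<^sub>R f) x = r *\<^sub>R f x"
  by (simp add: scaleR_fun_def)


subsection \<open>Smooth maps between open subsets of normed spaces\<close>

text \<open>
  The domain \<open>S\<close> is meant to be open and the spaces finite-dimensional: there, a map is of class
  \<open>C\<^bsup>k+1\<^esup>\<close> iff it is differentiable and all its directional derivatives are of class \<open>C\<^sup>k\<close>.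
\<close>

primrec k_smooth_on ::
    "nat \<Rightarrow> 'a::real_normed_vector set \<Rightarrow> ('a \<Rightarrow> 'b::real_normed_vector) \<Rightarrow> bool" where
  "k_smooth_on 0 S f \<longleftrightarrow> continuous_on S f"
| "k_smooth_on (Suc k) S f \<longleftrightarrow>
     (\<forall>x\<in>S. f differentiable (at x)) \<and>
     (\<forall>v. k_smooth_on k S (\<lambda>x. frechet_derivative f (at x) v))"

definition smooth_on ::
    "'a::real_normed_vector set \<Rightarrow> ('a \<Rightarrow> 'b::real_normed_vector) \<Rightarrow> bool" where
  "smooth_on S f \<longleftrightarrow> (\<forall>k. k_smooth_on k S f)"


subsection \<open>Atlases and manifolds\<close>

text \<open>
  A chart is a pair of its domain and a coordinate map; values of the coordinate map outside
  the domain are irrelevant. A manifold is given by an atlas: its points are those covered by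
  the charts, and its topology is the one induced by the charts. Atlases need not be maximal;
  all notions below depend only on the smooth structure the atlas generates (tangent vectors
  being indexed by the charts of the chosen atlas).
\<close>

type_synonym ('a, 'e) chart = "'a set \<times> ('a \<Rightarrow> 'e)"

abbreviation chart_dom :: "('a, 'e) chart \<Rightarrow> 'a set" where
  "chart_dom c \<equiv> fst c"

abbreviation chart_map :: "('a, 'e) chart \<Rightarrow> 'a \<Rightarrow> 'e" where
  "chart_map c \<equiv> snd c"

abbreviation chart_inv :: "('a, 'e) chart \<Rightarrow> 'e \<Rightarrow> 'a" where
  "chart_inv c \<equiv> inv_into (chart_dom c) (chart_map c)"

definition points :: "('a, 'e) chart set \<Rightarrow> 'a set" where
  "points A = (\<Union>c\<in>A. chart_dom c)"

definition transition :: "('a, 'e) chart \<Rightarrow> ('a, 'e) chart \<Rightarrow> 'e \<Rightarrow> 'e" where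
  "transition c d = chart_map d \<circ> chart_inv c"

definition smooth_atlas :: "('a, 'e::real_normed_vector) chart set \<Rightarrow> bool" where
  "smooth_atlas A \<longleftrightarrow>
     (\<forall>c\<in>A. inj_on (chart_map c) (chart_dom c) \<and> open (chart_map c ` chart_dom c)) \<and>
     (\<forall>c\<in>A. \<forall>d\<in>A. open (chart_map c ` (chart_dom c \<inter> chart_dom d)) \<and>
        smooth_on (chart_map c ` (chart_dom c \<inter> chart_dom d)) (transition c d))"

definition manifold_topology :: "('a, 'e::real_normed_vector) chart set \<Rightarrow> 'a topology" where
  "manifold_topology A =
     topology (\<lambda>W. W \<subseteq> points A \<and> (\<forall>c\<in>A. open (chart_map c ` (W \<inter> chart_dom c))))"

lemma openin_manifold_topology:
  assumes "smooth_atlas A"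
  shows "openin (manifold_topology A) W \<longleftrightarrow>
           W \<subseteq> points A \<and> (\<forall>c\<in>A. open (chart_map c ` (W \<inter> chart_dom c)))"
proof -
  let ?P = "\<lambda>W. W \<subseteq> points A \<and> (\<forall>c\<in>A. open (chart_map c ` (W \<inter> chart_dom c)))"
  have "istopology ?P"
    unfolding istopology_def
  proof (intro conjI allI impI)
    fix S T assume S: "?P S" and T: "?P T"
    have "open (chart_map c ` ((S \<inter> T) \<inter> chart_dom c))" if "c \<in> A" for c
    proof -
      have "inj_on (chart_map c) (chart_dom c)"
        using assms that by (auto simp: smooth_atlas_def)
      then have "chart_map c ` ((S \<inter> T) \<inter> chart_dom c) =
          chart_map c ` (S \<inter> chart_dom c) \<inter> chart_map c ` (T \<inter> chart_dom c)"
        by (auto simp: inj_on_def)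
      then show ?thesis
        using S T that by auto
    qed
    then show "S \<inter> T \<subseteq> points A" "\<forall>c\<in>A. open (chart_map c ` ((S \<inter> T) \<inter> chart_dom c))"
      using S by auto
  next
    fix \<K> assume K: "\<forall>W\<in>\<K>. ?P W"
    then show "\<Union>\<K> \<subseteq> points A"
      by blast
    show "\<forall>c\<in>A. open (chart_map c ` (\<Union>\<K> \<inter> chart_dom c))"
    proof
      fix c assume "c \<in> A"
      have "chart_map c ` (\<Union>\<K> \<inter> chart_dom c) = (\<Union>W\<in>\<K>. chart_map c ` (W \<inter> chart_dom c))"
        by blast
      then show "open (chart_map c ` (\<Union>\<K> \<inter> chart_dom c))"
        using K \<open>c \<in> A\<close> by auto
    qed
  qed
  then show ?thesis
    by (simp add: manifold_topology_def topology_inverse')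
qed

definition paracompact_space :: "'a topology \<Rightarrow> bool" where
  "paracompact_space X \<longleftrightarrow>
     (\<forall>\<U>. (\<forall>U\<in>\<U>. openin X U) \<and> \<Union>\<U> = topspace X \<longrightarrow>
        (\<exists>\<V>. (\<forall>V\<in>\<V>. openin X V) \<and> \<Union>\<V> = topspace X \<and>
             (\<forall>V\<in>\<V>. \<exists>U\<in>\<U>. V \<subseteq> U) \<and> locally_finite_in X \<V>))"

text \<open>
  The model space is an arbitrary finite-dimensional real inner product space rather than a
  type of class \<open>euclidean_space\<close>, since the latter excludes dimension zero.
\<close>

definition smooth_manifold :: "('a, 'e::real_inner) chart set \<Rightarrow> bool" where
  "smooth_manifold A \<longleftrightarrow>
     (\<exists>B::'e set. finite B \<and> span B = UNIV) \<and>
     smooth_atlas A \<and>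
     Hausdorff_space (manifold_topology A) \<and>
     paracompact_space (manifold_topology A) \<and>
     connected_space (manifold_topology A)"

definition smooth_map_on ::
    "('a, 'e::real_normed_vector) chart set \<Rightarrow> 'a set \<Rightarrow> ('b, 'f::real_normed_vector) chart set
      \<Rightarrow> ('a \<Rightarrow> 'b) \<Rightarrow> bool" where
  "smooth_map_on A W B f \<longleftrightarrow>
     openin (manifold_topology A) W \<and> f ` W \<subseteq> points B \<and>
     (\<forall>c\<in>A. \<forall>d\<in>B.
        let D = chart_map c ` {p \<in> W \<inter> chart_dom c. f p \<in> chart_dom d}
        in open D \<and> smooth_on D (chart_map d \<circ> f \<circ> chart_inv c))"


subsection \<open>The tangent functor\<close>

text \<open>
  A tangent vector at \<open>p\<close> is the family of its components with respect to the charts around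
  \<open>p\<close>, transforming by the derivatives of the transition maps (and zero at all other indices).
  Elements of the tangent bundle are pairs of a base point and a tangent vector there, so the
  bundle projections \<open>\<pi>\<close> and \<open>\<pi>\<^sub>T\<close> are both \<open>fst\<close>, and the fibre of a
  subset \<open>E\<close> of a tangent bundle over \<open>q\<close> is \<open>E `` {q}\<close>.
\<close>

type_synonym ('a, 'e) tvec = "'a \<times> (('a, 'e) chart \<Rightarrow> 'e)"

definition tangent_space ::
    "('a, 'e::real_normed_vector) chart set \<Rightarrow> 'a \<Rightarrow> (('a, 'e) chart \<Rightarrow> 'e) set" where
  "tangent_space A p =
     {\<xi>. (\<forall>c\<in>A. \<forall>d\<in>A. p \<in> chart_dom c \<and> p \<in> chart_dom d \<longrightarrow>
            \<xi> d = frechet_derivative (transition c d) (at (chart_map c p)) (\<xi> c)) \<and>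
         (\<forall>c. \<not> (c \<in> A \<and> p \<in> chart_dom c) \<longrightarrow> \<xi> c = 0)}"

definition tangent_bundle :: "('a, 'e::real_normed_vector) chart set \<Rightarrow> ('a, 'e) tvec set" where
  "tangent_bundle A = (SIGMA p:points A. tangent_space A p)"

definition tangent_chart ::
    "('a, 'e::real_normed_vector) chart set \<Rightarrow> ('a, 'e) chart
      \<Rightarrow> (('a, 'e) tvec, 'e \<times> 'e) chart" where
  "tangent_chart A c =
     ({v \<in> tangent_bundle A. fst v \<in> chart_dom c}, \<lambda>v. (chart_map c (fst v), snd v c))"

definition tangent_atlas ::
    "('a, 'e::real_normed_vector) chart set \<Rightarrow> (('a, 'e) tvec, 'e \<times> 'e) chart set" where
  "tangent_atlas A = tangent_chart A ` A"

lemma points_tangent_atlas: "points (tangent_atlas A) = tangent_bundle A"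
  by (auto simp: points_def tangent_atlas_def tangent_chart_def tangent_bundle_def)

lemma subspace_tangent_space:
  assumes "smooth_atlas A"
  shows "subspace (tangent_space A p)"
proof -
  have "linear (frechet_derivative (transition c d) (at (chart_map c p)))"
    if "c \<in> A" "d \<in> A" "p \<in> chart_dom c" "p \<in> chart_dom d" for c d
  proof -
    have "k_smooth_on (Suc 0) (chart_map c ` (chart_dom c \<inter> chart_dom d)) (transition c d)"
      using assms that unfolding smooth_atlas_def smooth_on_def by blast
    then have "transition c d differentiable (at (chart_map c p))"
      using that by auto
    then show ?thesis
      by (rule linear_frechet_derivative)
  qed
  then have lin:
      "frechet_derivative (transition c d) (at (chart_map c p)) 0 = 0"
      "frechet_derivative (transition c d) (at (chart_map c p)) (x + y) =
        frechet_derivative (transition c d) (at (chart_map c p)) x +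
        frechet_derivative (transition c d) (at (chart_map c p)) y"
      "frechet_derivative (transition c d) (at (chart_map c p)) (r *\<^sub>R x) =
        r *\<^sub>R frechet_derivative (transition c d) (at (chart_map c p)) x"
    if "c \<in> A" "d \<in> A" "p \<in> chart_dom c" "p \<in> chart_dom d" for c d x y r
    using that by (blast intro: linear_0 linear_add linear_scale)+
  show ?thesis
  proof (rule subspaceI)
    show "0 \<in> tangent_space A p"
      unfolding tangent_space_def by (simp add: lin(1))
  next
    fix \<xi> \<eta> assume "\<xi> \<in> tangent_space A p" "\<eta> \<in> tangent_space A p"
    then show "\<xi> + \<eta> \<in> tangent_space A p"
      unfolding tangent_space_def mem_Collect_eq plus_fun_apply
      by (metis (no_types, lifting) lin(2) add_0)
  next
    fix r \<xi> assume "\<xi> \<in> tangent_space A p"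
    then show "r *\<^sub>R \<xi> \<in> tangent_space A p"
      unfolding tangent_space_def mem_Collect_eq scaleR_fun_apply
      by (metis (no_types, lifting) lin(3) scaleR_zero_right)
  qed
qed

text \<open>
  The tangent map of \<open>f\<close>: the unique tangent vector at \<open>f p\<close> whose components are
  obtained by applying the derivative of the local representative of \<open>f\<close>.
\<close>

definition tangent_map ::
    "('a, 'e::real_normed_vector) chart set \<Rightarrow> ('b, 'f::real_normed_vector) chart set
      \<Rightarrow> ('a \<Rightarrow> 'b) \<Rightarrow> ('a, 'e) tvec \<Rightarrow> ('b, 'f) tvec" where
  "tangent_map A B f v =
     (f (fst v),
      THE \<eta>. \<eta> \<in> tangent_space B (f (fst v)) \<and>
         (\<forall>c\<in>A. \<forall>d\<in>B. fst v \<in> chart_dom c \<and> f (fst v) \<in> chart_dom d \<longrightarrow>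
            \<eta> d = frechet_derivative (chart_map d \<circ> f \<circ> chart_inv c)
                    (at (chart_map c (fst v))) (snd v c)))"

definition velocity ::
    "('a, 'e::real_normed_vector) chart set \<Rightarrow> (real \<Rightarrow> 'a) \<Rightarrow> real \<Rightarrow> ('a, 'e) tvec" where
  "velocity A \<gamma> t =
     (\<gamma> t, \<lambda>c. if c \<in> A \<and> \<gamma> t \<in> chart_dom c
               then vector_derivative (chart_map c \<circ> \<gamma>) (at t) else 0)"

text \<open>Vector fields are extensional, so that equality of vector fields is equality on the manifold.\<close>

definition vector_fields ::
    "('a, 'e::real_normed_vector) chart set \<Rightarrow> ('a \<Rightarrow> ('a, 'e) tvec) set" where
  "vector_fields A =
     {V \<in> extensional (points A).
        smooth_map_on A (points A) (tangent_atlas A) V \<and> (\<forall>p\<in>points A. fst (V p) = p)}"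

text \<open>
  A smooth subbundle of the tangent bundle: a subset of the bundle having, locally on the base,
  a frame of smooth sections.
\<close>

definition smooth_subbundle ::
    "('a, 'e::real_normed_vector) chart set \<Rightarrow> ('a, 'e) tvec set \<Rightarrow> bool" where
  "smooth_subbundle A E \<longleftrightarrow>
     E \<subseteq> tangent_bundle A \<and>
     (\<forall>p\<in>points A. \<exists>W k. \<exists>X :: nat \<Rightarrow> 'a \<Rightarrow> ('a, 'e) tvec.
        openin (manifold_topology A) W \<and> p \<in> W \<and>
        (\<forall>i<k. smooth_map_on A W (tangent_atlas A) (X i)) \<and>
        (\<forall>q\<in>W. (\<forall>i<k. fst (X i q) = q) \<and>
                inj_on (\<lambda>i. snd (X i q)) {..<k} \<and>
                independent ((\<lambda>i. snd (X i q)) ` {..<k}) \<and>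
                span ((\<lambda>i. snd (X i q)) ` {..<k}) = E `` {q}))"


subsection \<open>Nonlinear connections and their covariant derivatives\<close>

text \<open>Below, \<open>A\<close> is an atlas of \<open>M\<close>, and \<open>TTM\<close> is the tangent bundle of \<open>tangent_atlas A\<close>.\<close>

definition vertical_bundle ::
    "('a, 'e::real_normed_vector) chart set \<Rightarrow> (('a, 'e) tvec, 'e \<times> 'e) tvec set" where
  "vertical_bundle A =
     {z \<in> tangent_bundle (tangent_atlas A). snd (tangent_map (tangent_atlas A) A fst z) = 0}"

definition connection ::
    "('a, 'e::real_normed_vector) chart set \<Rightarrow> (('a, 'e) tvec, 'e \<times> 'e) tvec set \<Rightarrow> bool" where
  "connection A H \<longleftrightarrow>
     smooth_subbundle (tangent_atlas A) H \<and>
     (\<forall>v\<in>tangent_bundle A.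
        H `` {v} \<inter> vertical_bundle A `` {v} = {0} \<and>
        {h + w | h w. h \<in> H `` {v} \<and> w \<in> vertical_bundle A `` {v}}
          = tangent_space (tangent_atlas A) v)"

definition horizontal_projection ::
    "('a, 'e::real_normed_vector) chart set \<Rightarrow> (('a, 'e) tvec, 'e \<times> 'e) tvec set
      \<Rightarrow> (('a, 'e) tvec, 'e \<times> 'e) tvec \<Rightarrow> (('a, 'e) tvec, 'e \<times> 'e) tvec" where
  "horizontal_projection A H z =
     (fst z, THE h. h \<in> H `` {fst z} \<and> snd z - h \<in> vertical_bundle A `` {fst z})"

text \<open>
  The canonical identification of \<open>T\<^sub>pM\<close> with \<open>T\<^sub>v(T\<^sub>pM)\<close> sends \<open>w\<close> to the velocity at
  \<open>t = 0\<close> of the line \<open>v + t w\<close> in \<open>T\<^sub>pM\<close>; the canonical map \<open>K\<close> is its inverse.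
\<close>

definition vertical_lift ::
    "('a, 'e::real_normed_vector) chart set \<Rightarrow> ('a, 'e) tvec \<Rightarrow> (('a, 'e) chart \<Rightarrow> 'e)
      \<Rightarrow> (('a, 'e) tvec, 'e \<times> 'e) tvec" where
  "vertical_lift A v w = velocity (tangent_atlas A) (\<lambda>t. (fst v, snd v + t *\<^sub>R w)) 0"

definition canonical_K ::
    "('a, 'e::real_normed_vector) chart set \<Rightarrow> (('a, 'e) tvec, 'e \<times> 'e) tvec \<Rightarrow> ('a, 'e) tvec" where
  "canonical_K A z =
     (let p = fst (fst z) in
      (p, THE w. w \<in> tangent_space A p \<and> vertical_lift A (fst z) w = z))"

definition connector ::
    "('a, 'e::real_normed_vector) chart set \<Rightarrow> (('a, 'e) tvec, 'e \<times> 'e) tvec set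
      \<Rightarrow> (('a, 'e) tvec, 'e \<times> 'e) tvec \<Rightarrow> ('a, 'e) tvec" where
  "connector A H z = canonical_K A (fst z, snd z - snd (horizontal_projection A H z))"

text \<open>An operator on pairs \<open>(U, V)\<close> of vector fields, extended by \<open>undefined\<close> to all other pairs.\<close>

definition covariant_derivative ::
    "('a, 'e::real_normed_vector) chart set \<Rightarrow> (('a, 'e) tvec, 'e \<times> 'e) tvec set
      \<Rightarrow> ('a \<Rightarrow> ('a, 'e) tvec) \<times> ('a \<Rightarrow> ('a, 'e) tvec) \<Rightarrow> ('a \<Rightarrow> ('a, 'e) tvec)" where
  "covariant_derivative A H =
     (\<lambda>(U, V) \<in> vector_fields A \<times> vector_fields A.
        \<lambda>p\<in>points A. connector A H (tangent_map A (tangent_atlas A) V (U p)))"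

definition connections ::
    "('a, 'e::real_normed_vector) chart set \<Rightarrow> (('a, 'e) tvec, 'e \<times> 'e) tvec set set" where
  "connections A = {H. connection A H}"

definition covariant_derivatives ::
    "('a, 'e::real_normed_vector) chart set
      \<Rightarrow> (('a \<Rightarrow> ('a, 'e) tvec) \<times> ('a \<Rightarrow> ('a, 'e) tvec) \<Rightarrow> ('a \<Rightarrow> ('a, 'e) tvec)) set" where
  "covariant_derivatives A = {D. \<exists>H. connection A H \<and> D = covariant_derivative A H}"

end

(*
  A connection H is recovered from its covariant derivative as follows. Given h in H over v, let
  u be the projection of h to M and choose global vector fields U and V through u and v; they exist
  by multiplying a coordinate-constant field by a bump function. The vector V_* u projects to u as
  well, so it differs from h by a vertical vector and h is its horizontal part. Since K is injective
  on vertical vectors at v, the value of nabla_U V at the base point determines h.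
*)

theory Submission
  imports Defs
begin

subsection \<open>Calculus of smooth maps\<close>

text \<open>The target set consists by definition of the operators that come from connections, so
  only injectivity has content, and since the hypothesis is symmetric, one inclusion between two
  connections suffices. The comparison works because \<open>V_* u\<close> is formed without any
  connection: one and the same vector is split along both. Two obstacles shape the rest. Tangent
  vectors are families of chart components, and \<open>tangent_map\<close>,
  \<open>horizontal_projection\<close> and \<open>canonical_K\<close> are definite descriptions, so
  each must be shown to have exactly one candidate before it can be computed. For the first and the
  last this rests on the chain rule for the transition maps of M and of TM. Moreover the vector
  fields must be global: extension by zero is smooth because a compact ball of a chart is closed in
  a Hausdorff manifold. The model space comes with an inner product and a finite spanning set, but
  no fixed basis; coordinates and compact balls are obtained from that set.\<close>

lemma k_smooth_on_subset:
  "k_smooth_on k T f \<Longrightarrow> S \<subseteq> T \<Longrightarrow> k_smooth_on k S f"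
  by (induction k arbitrary: f) (auto intro: continuous_on_subset)

text \<open>\<open>frechet_derivative\<close> is a choice among the derivatives at \<open>x\<close>.
  Functions that agree near \<open>x\<close> have the same derivatives there, so the choices
  coincide even where no derivative exists.\<close>

lemma frechet_derivative_cong_open:
  assumes "open S" "x \<in> S" "\<And>y. y \<in> S \<Longrightarrow> f y = g y"
  shows "frechet_derivative f (at x) = frechet_derivative g (at x)"
proof -
  have "(f has_derivative D) (at x) \<longleftrightarrow> (g has_derivative D) (at x)" for D
    using assms has_derivative_transform_within_open[of f D x UNIV S g]
      has_derivative_transform_within_open[of g D x UNIV S f] by auto
  then show ?thesis
    by (simp add: frechet_derivative_def)
qed

lemma k_smooth_on_cong:
  assumes "open S" "k_smooth_on k S f" "\<And>y. y \<in> S \<Longrightarrow> f y = g y"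
  shows "k_smooth_on k S g"
  using assms(2,3)
proof (induction k arbitrary: f g)
  case 0
  then show ?case by (auto cong: continuous_on_cong)
next
  case (Suc k)
  have "g differentiable at x" if x: "x \<in> S" for x
  proof -
    obtain D where "(f has_derivative D) (at x)"
      using Suc.prems(1) x by (auto simp: differentiable_def)
    then show ?thesis
      by (intro differentiableI, rule has_derivative_transform_within_open[OF _ assms(1) x])
         (rule Suc.prems(2))
  qed
  moreover have "k_smooth_on k S (\<lambda>x. frechet_derivative g (at x) v)" for v
    by (rule Suc.IH[of "\<lambda>x. frechet_derivative f (at x) v"])
       (use Suc.prems frechet_derivative_cong_open[OF assms(1) _ Suc.prems(2)] in auto)
  ultimately show ?case by simp
qed

text \<open>Derivatives at a point are unique, so an explicit formula \<open>f'\<close> may stand in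
  for the chosen one. Most closure properties below take their induction step through this
  rule.\<close>

lemma k_smooth_on_SucI:
  assumes "open S" "\<And>x. x \<in> S \<Longrightarrow> (f has_derivative f' x) (at x)"
    and "\<And>v. k_smooth_on k S (\<lambda>x. f' x v)"
  shows "k_smooth_on (Suc k) S f"
proof -
  have "frechet_derivative f (at x) = f' x" if "x \<in> S" for x
    using assms(2)[OF that] frechet_derivative_at by metis
  moreover from this have "k_smooth_on k S (\<lambda>x. frechet_derivative f (at x) v)" for v
    by (intro k_smooth_on_cong[OF assms(1) assms(3)[of v]]) auto
  ultimately show ?thesis
    using assms(2) by (auto intro: differentiableI)
qed

lemma k_smooth_on_Suc_has_derivative:
  "k_smooth_on (Suc k) S f \<Longrightarrow> x \<in> S \<Longrightarrow> (f has_derivative frechet_derivative f (at x)) (at x)"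
  by (simp add: frechet_derivative_works[symmetric])

lemma k_smooth_on_Suc_derivative:
  "k_smooth_on (Suc k) S f \<Longrightarrow> k_smooth_on k S (\<lambda>x. frechet_derivative f (at x) v)"
  by simp

declare k_smooth_on.simps(2) [simp del]

lemma k_smooth_on_Suc_D: "k_smooth_on (Suc k) S f \<Longrightarrow> k_smooth_on k S f"
proof (induction k arbitrary: f)
  case 0
  then show ?case
    by (auto simp: k_smooth_on.simps(2) intro!: continuous_at_imp_continuous_on
        differentiable_imp_continuous_within)
next
  case (Suc k)
  have "f differentiable (at x)" if "x \<in> S" for x
    using Suc.prems that by (simp add: k_smooth_on.simps(2))
  moreover have "k_smooth_on k S (\<lambda>x. frechet_derivative f (at x) v)" for v
    by (rule Suc.IH[OF k_smooth_on_Suc_derivative[OF Suc.prems]])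
  ultimately show ?case
    by (simp add: k_smooth_on.simps(2))
qed

section \<open>Stability of smoothness of order k under algebraic operations and composition\<close>

lemma k_smooth_on_const: "open S \<Longrightarrow> k_smooth_on k S (\<lambda>x. c)"
proof (induction k arbitrary: c)
  case (Suc k)
  show ?case
    by (rule k_smooth_on_SucI[where f' = "\<lambda>x v. 0"]) (use Suc in auto)
qed auto

lemma k_smooth_on_bounded_linear:
  assumes "bounded_linear L" "open S" "k_smooth_on k S f"
  shows "k_smooth_on k S (\<lambda>x. L (f x))"
  using assms(3)
proof (induction k arbitrary: f)
  case 0
  then show ?case
    by (auto intro: bounded_linear.continuous_on[OF assms(1)])
next
  case (Suc k)
  show ?case
    by (rule k_smooth_on_SucI[OF assms(2),
          where f' = "\<lambda>x v. L (frechet_derivative f (at x) v)"])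
       (auto intro!: Suc.IH bounded_linear.has_derivative[OF assms(1)]
          k_smooth_on_Suc_has_derivative[OF Suc.prems] k_smooth_on_Suc_derivative[OF Suc.prems])
qed

lemma k_smooth_on_id: "open S \<Longrightarrow> k_smooth_on k S (\<lambda>x. x)"
proof (cases k)
  case (Suc j)
  assume "open S"
  then show ?thesis
    unfolding Suc by (rule k_smooth_on_SucI[where f' = "\<lambda>x v. v"])
      (auto intro: k_smooth_on_const \<open>open S\<close>)
qed auto

lemma k_smooth_on_add:
  assumes "open S" "k_smooth_on k S f" "k_smooth_on k S g"
  shows "k_smooth_on k S (\<lambda>x. f x + g x)"
  using assms(2,3)
proof (induction k arbitrary: f g)
  case (Suc k)
  show ?case
    by (rule k_smooth_on_SucI[OF assms(1), where f' = "\<lambda>x v. frechet_derivative f (at x) v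
          + frechet_derivative g (at x) v"])
       (auto intro!: Suc.IH has_derivative_add k_smooth_on_Suc_has_derivative Suc.prems
          k_smooth_on_Suc_derivative)
qed (auto intro: continuous_on_add)

lemma k_smooth_on_sum:
  assumes "open S" "\<And>i. i \<in> I \<Longrightarrow> k_smooth_on k S (f i)"
  shows "k_smooth_on k S (\<lambda>x. \<Sum>i\<in>I. f i x)"
  using assms(2)
proof (induction I rule: infinite_finite_induct)
  case (insert i I)
  then show ?case
    by (simp add: k_smooth_on_add[OF assms(1)])
qed (auto intro: k_smooth_on_const[OF assms(1)])

text \<open>The product rule pairs the derivative of one factor with the other factor itself; the
  undifferentiated factor is then used one order lower, by \<open>k_smooth_on_Suc_D\<close>.\<close>

lemma k_smooth_on_bounded_bilinear:
  assumes "bounded_bilinear h" "open S" "k_smooth_on k S f" "k_smooth_on k S g"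
  shows "k_smooth_on k S (\<lambda>x. h (f x) (g x))"
  using assms(3,4)
proof (induction k arbitrary: f g)
  case 0
  then show ?case
    by (auto intro: bounded_bilinear.continuous_on[OF assms(1)])
next
  case (Suc k)
  show ?case
    by (rule k_smooth_on_SucI[OF assms(2), where f' = "\<lambda>x v. h (f x) (frechet_derivative g (at x) v)
          + h (frechet_derivative f (at x) v) (g x)"])
       (use Suc.prems in \<open>auto intro!: k_smooth_on_add[OF assms(2)] Suc.IH
          bounded_bilinear.FDERIV[OF assms(1)] k_smooth_on_Suc_has_derivative
          intro: k_smooth_on_Suc_derivative k_smooth_on_Suc_D\<close>)
qed

lemma k_smooth_on_Pair:
  assumes "open S" "k_smooth_on k S f" "k_smooth_on k S g"
  shows "k_smooth_on k S (\<lambda>x. (f x, g x))"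
  using assms(2,3)
proof (induction k arbitrary: f g)
  case (Suc k)
  show ?case
    by (rule k_smooth_on_SucI[OF assms(1), where f' = "\<lambda>x v. (frechet_derivative f (at x) v,
          frechet_derivative g (at x) v)"])
       (auto intro!: Suc.IH has_derivative_Pair k_smooth_on_Suc_has_derivative Suc.prems
          k_smooth_on_Suc_derivative)
qed (auto intro: continuous_on_Pair)

text \<open>Derivatives are taken in the full space, so differentiability is a pointwise condition;
  openness of the two sets serves the continuity at order 0. This glues the two pieces of a field
  extended by zero.\<close>

lemma k_smooth_on_Un:
  assumes "open S" "open T" "k_smooth_on k S f" "k_smooth_on k T f"
  shows "k_smooth_on k (S \<union> T) f"
  using assms(3,4)
  by (induction k arbitrary: f)
     (auto simp: k_smooth_on.simps(2) intro: continuous_on_open_Un[OF assms(1,2)])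

text \<open>Gram-Schmidt gives an orthogonal spanning set \<open>C\<close>, and \<open>g b\<close>
  is the vector dual to \<open>b\<close>. The set may contain 0; that term vanishes, since division
  by zero gives 0.\<close>

lemma finite_dim_coordinates:
  fixes B :: "'e::real_inner set"
  assumes "finite B" "span B = UNIV"
  shows "\<exists>C. \<exists>g :: 'e \<Rightarrow> 'e. finite C \<and> (\<forall>x. (\<Sum>b\<in>C. (x \<bullet> g b) *\<^sub>R b) = x)"
proof -
  obtain C :: "'e set" where C: "finite C" "span C = UNIV" "pairwise orthogonal C"
    using basis_orthogonal[OF assms(1)] assms(2) by auto
  define g :: "'e \<Rightarrow> 'e" where "g b = b /\<^sub>R (b \<bullet> b)" for b
  have "(\<Sum>b\<in>C. (x \<bullet> g b) *\<^sub>R b) = x" for x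
  proof -
    have "x \<in> span C" using C by simp
    then show ?thesis
    proof (induction rule: span_induct_alt)
      case base
      then show ?case by simp
    next
      case (step c b y)
      have "(b \<bullet> g d) *\<^sub>R d = (if d = b then b else 0)" if "d \<in> C" for d
        using C(3) step.hyps that by (cases "b = 0") (auto simp: g_def pairwise_def orthogonal_def)
      then have "(\<Sum>d\<in>C. (b \<bullet> g d) *\<^sub>R d) = b"
        using C(1) step.hyps by (simp cong: sum.cong)
      moreover have "(\<Sum>d\<in>C. ((c *\<^sub>R b + y) \<bullet> g d) *\<^sub>R d) =
          c *\<^sub>R (\<Sum>d\<in>C. (b \<bullet> g d) *\<^sub>R d) + (\<Sum>d\<in>C. (y \<bullet> g d) *\<^sub>R d)"
        by (simp add: inner_add_left scaleR_add_left sum.distrib scaleR_sum_right)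
      ultimately show ?case
        using step.IH by simp
    qed
  qed
  with C(1) show ?thesis by (intro exI conjI allI)
qed

text \<open>
  Coordinates turn the operator-valued map \<open>Dg \<circ> f\<close> of the chain rule into finitely many
  directional derivatives, which is what makes the induction on the order go through.
\<close>

lemma k_smooth_on_compose:
  fixes f :: "'a::real_normed_vector \<Rightarrow> 'b::real_inner" and g :: "'b \<Rightarrow> 'c::real_normed_vector"
  assumes "finite (B :: 'b set)" "span B = UNIV"
    and "open S" "f ` S \<subseteq> T" "k_smooth_on k S f" "k_smooth_on k T g"
  shows "k_smooth_on k S (\<lambda>x. g (f x))"
proof -
  obtain C and c :: "'b \<Rightarrow> 'b" where C: "finite C" "\<forall>x. (\<Sum>b\<in>C. (x \<bullet> c b) *\<^sub>R b) = x"
    using finite_dim_coordinates[OF assms(1,2)] by (elim exE conjE) (rule that)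
  show ?thesis
    using assms(5,6)
  \<comment> \<open>Only \<open>g\<close> has to vary: the inductive hypothesis is applied to the
    directional derivative of \<open>g\<close> along \<open>b\<close>, composed with the same
    \<open>f\<close>.\<close>
  proof (induction k arbitrary: g)
    case 0
    then show ?case
      using continuous_on_compose2[OF _ _ assms(4), of g] by simp
  next
    case (Suc k)
    have "k_smooth_on k S (\<lambda>x. frechet_derivative g (at (f x)) (frechet_derivative f (at x) v))" for v
    proof -
      have "k_smooth_on k S (\<lambda>x. \<Sum>b\<in>C. (frechet_derivative f (at x) v \<bullet> c b) *\<^sub>R
          frechet_derivative g (at (f x)) b)"
      proof (rule k_smooth_on_sum[OF assms(3)])
        fix b
        have 1: "k_smooth_on k S (\<lambda>x. frechet_derivative f (at x) v \<bullet> c b)"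
          by (rule k_smooth_on_bounded_linear[OF bounded_linear_inner_left assms(3)
              k_smooth_on_Suc_derivative[OF Suc.prems(1)]])
        have 2: "k_smooth_on k S (\<lambda>x. frechet_derivative g (at (f x)) b)"
          by (rule Suc.IH[OF k_smooth_on_Suc_D[OF Suc.prems(1)]
              k_smooth_on_Suc_derivative[OF Suc.prems(2)]])
        show "k_smooth_on k S (\<lambda>x. (frechet_derivative f (at x) v \<bullet> c b) *\<^sub>R
            frechet_derivative g (at (f x)) b)"
          using k_smooth_on_bounded_bilinear[OF bounded_bilinear_scaleR assms(3) 1 2] .
      qed
      moreover have "(\<Sum>b\<in>C. (frechet_derivative f (at x) v \<bullet> c b) *\<^sub>R
          frechet_derivative g (at (f x)) b) =
          frechet_derivative g (at (f x)) (frechet_derivative f (at x) v)" if "x \<in> S" for x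
      proof -
        have "linear (frechet_derivative g (at (f x)))"
          using that assms(4)
          by (intro has_derivative_linear[OF k_smooth_on_Suc_has_derivative[OF Suc.prems(2)]]) auto
        from linear_sum[OF this, of "\<lambda>b. (frechet_derivative f (at x) v \<bullet> c b) *\<^sub>R b" C]
        show ?thesis
          by (simp add: C(2) linear_scale[OF \<open>linear (frechet_derivative g (at (f x)))\<close>])
      qed
      ultimately show ?thesis
        by (rule k_smooth_on_cong[OF assms(3)])
    qed
    moreover have "((\<lambda>x. g (f x)) has_derivative
        (\<lambda>v. frechet_derivative g (at (f x)) (frechet_derivative f (at x) v))) (at x)"
      if "x \<in> S" for x
      using that assms(4)
      by (intro has_derivative_compose[OF k_smooth_on_Suc_has_derivative[OF Suc.prems(1)]
          k_smooth_on_Suc_has_derivative[OF Suc.prems(2)]]) auto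
    ultimately show ?case
      by (rule k_smooth_on_SucI[OF assms(3), rotated])
  qed
qed

section \<open>The same rules for maps smooth of every order\<close>

lemma smooth_on_has_derivative:
  "smooth_on S f \<Longrightarrow> x \<in> S \<Longrightarrow> (f has_derivative frechet_derivative f (at x)) (at x)"
  by (metis smooth_on_def k_smooth_on_Suc_has_derivative)

lemma smooth_on_derivative:
  "smooth_on S f \<Longrightarrow> smooth_on S (\<lambda>x. frechet_derivative f (at x) v)"
  by (metis smooth_on_def k_smooth_on_Suc_derivative)

lemma smooth_on_subset: "smooth_on T f \<Longrightarrow> S \<subseteq> T \<Longrightarrow> smooth_on S f"
  by (metis smooth_on_def k_smooth_on_subset)

lemma smooth_on_cong:
  "open S \<Longrightarrow> smooth_on S f \<Longrightarrow> (\<And>y. y \<in> S \<Longrightarrow> f y = g y) \<Longrightarrow> smooth_on S g"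
  unfolding smooth_on_def by (blast intro: k_smooth_on_cong)

lemma smooth_on_const: "open S \<Longrightarrow> smooth_on S (\<lambda>x. c)"
  by (simp add: smooth_on_def k_smooth_on_const)

lemma smooth_on_id: "open S \<Longrightarrow> smooth_on S (\<lambda>x. x)"
  by (simp add: smooth_on_def k_smooth_on_id)

lemma smooth_on_bounded_linear:
  "bounded_linear L \<Longrightarrow> open S \<Longrightarrow> smooth_on S f \<Longrightarrow> smooth_on S (\<lambda>x. L (f x))"
  by (simp add: smooth_on_def k_smooth_on_bounded_linear)

lemma smooth_on_sum:
  "open S \<Longrightarrow> (\<And>i. i \<in> I \<Longrightarrow> smooth_on S (f i)) \<Longrightarrow> smooth_on S (\<lambda>x. \<Sum>i\<in>I. f i x)"
  by (simp add: smooth_on_def k_smooth_on_sum)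

lemma smooth_on_bounded_bilinear:
  "bounded_bilinear h \<Longrightarrow> open S \<Longrightarrow> smooth_on S f \<Longrightarrow> smooth_on S g \<Longrightarrow> smooth_on S (\<lambda>x. h (f x) (g x))"
  by (simp add: smooth_on_def k_smooth_on_bounded_bilinear)

lemma smooth_on_Pair:
  "open S \<Longrightarrow> smooth_on S f \<Longrightarrow> smooth_on S g \<Longrightarrow> smooth_on S (\<lambda>x. (f x, g x))"
  by (simp add: smooth_on_def k_smooth_on_Pair)

lemma smooth_on_Un:
  "open S \<Longrightarrow> open T \<Longrightarrow> smooth_on S f \<Longrightarrow> smooth_on T f \<Longrightarrow> smooth_on (S \<union> T) f"
  by (simp add: smooth_on_def k_smooth_on_Un)

lemma smooth_on_compose:
  fixes f :: "'a::real_normed_vector \<Rightarrow> 'b::real_inner" and g :: "'b \<Rightarrow> 'c::real_normed_vector"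
  assumes "finite (B :: 'b set)" "span B = UNIV" "open S" "f ` S \<subseteq> T" "smooth_on S f" "smooth_on T g"
  shows "smooth_on S (\<lambda>x. g (f x))"
  using assms unfolding smooth_on_def by (blast intro: k_smooth_on_compose)

subsection \<open>Bump functions\<close>

text \<open>By Cauchy-Schwarz the coordinates relative to \<open>a\<close> are bounded by
  \<open>norm (g b) * r\<close> on the ball, so the ball is a closed part of a coordinate box. The
  box is compact by induction on the directions: adding one gives a continuous image of a product
  with a compact interval.\<close>

lemma compact_cball_finite_dim:
  fixes B :: "'e::real_inner set"
  assumes "finite B" "span B = UNIV"
  shows "compact (cball a r :: 'e set)"
proof -
  obtain C and g :: "'e \<Rightarrow> 'e" where C: "finite C" "\<forall>x. (\<Sum>b\<in>C. (x \<bullet> g b) *\<^sub>R b) = x"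
    using finite_dim_coordinates[OF assms] by (elim exE conjE) (rule that)
  define box :: "'e set \<Rightarrow> 'e set" where
    "box D = {a + (\<Sum>b\<in>D. f b *\<^sub>R b) |f. \<forall>b\<in>D. \<bar>f b\<bar> \<le> norm (g b) * r}" for D
  have "compact (box D)" if "finite D" for D
    using that
  proof (induction D)
    case empty
    then show ?case by (simp add: box_def)
  next
    case (insert b D)
    have "compact ((\<lambda>(x, t). x + t *\<^sub>R b) ` (box D \<times> {- (norm (g b) * r)..norm (g b) * r}))"
      by (intro compact_continuous_image compact_Times insert.IH compact_Icc)
        (auto simp: case_prod_unfold intro!: continuous_intros)
    also have "(\<lambda>(x, t). x + t *\<^sub>R b) ` (box D \<times> {- (norm (g b) * r)..norm (g b) * r}) = box (insert b D)"
      (is "?L = ?R")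
    proof (intro subset_antisym subsetI)
      fix z assume "z \<in> ?L"
      then obtain f t where z: "z = a + (\<Sum>b\<in>D. f b *\<^sub>R b) + t *\<^sub>R b"
        and f: "\<forall>b\<in>D. \<bar>f b\<bar> \<le> norm (g b) * r" "\<bar>t\<bar> \<le> norm (g b) * r"
        by (auto simp: box_def abs_le_iff)
      have "(\<Sum>d\<in>D. (f(b := t)) d *\<^sub>R d) = (\<Sum>b\<in>D. f b *\<^sub>R b)"
        using insert.hyps by (intro sum.cong) auto
      then have "z = a + (\<Sum>d\<in>insert b D. (f(b := t)) d *\<^sub>R d)"
        using insert.hyps by (simp add: z)
      moreover have "\<forall>d\<in>insert b D. \<bar>(f(b := t)) d\<bar> \<le> norm (g d) * r"
        using f by auto
      ultimately show "z \<in> ?R"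
        unfolding box_def by blast
    next
      fix z assume "z \<in> ?R"
      then obtain f where z: "z = a + (\<Sum>b\<in>insert b D. f b *\<^sub>R b)"
        and f: "\<forall>b\<in>insert b D. \<bar>f b\<bar> \<le> norm (g b) * r"
        by (auto simp: box_def)
      have "a + (\<Sum>b\<in>D. f b *\<^sub>R b) \<in> box D"
        using f by (auto simp: box_def)
      moreover have "z = (case (a + (\<Sum>b\<in>D. f b *\<^sub>R b), f b) of (x, t) \<Rightarrow> x + t *\<^sub>R b)"
        using insert.hyps by (simp add: z)
      moreover have "f b \<in> {- (norm (g b) * r)..norm (g b) * r}"
        using f by (auto simp: abs_le_iff)
      ultimately show "z \<in> ?L"
        by blast
    qed
    finally show ?case .
  qed
  then have "compact (cball a r \<inter> box C)"
    using C(1) by (intro closed_Int_compact) auto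
  moreover have "x \<in> box C" if "x \<in> cball a r" for x
  proof -
    have "x = a + (\<Sum>b\<in>C. ((x - a) \<bullet> g b) *\<^sub>R b)"
      by (simp add: C(2))
    moreover have "\<bar>(x - a) \<bullet> g b\<bar> \<le> norm (g b) * r" for b
    proof -
      have "\<bar>(x - a) \<bullet> g b\<bar> \<le> norm (x - a) * norm (g b)"
        by (rule Cauchy_Schwarz_ineq2)
      also have "\<dots> \<le> r * norm (g b)"
        using that by (intro mult_right_mono) (auto simp: dist_norm norm_minus_commute)
      finally show ?thesis by (simp add: mult.commute)
    qed
    ultimately show ?thesis
      unfolding box_def mem_Collect_eq
      by (intro exI[of _ "\<lambda>b. (x - a) \<bullet> g b"] conjI ballI)
  qed
  ultimately show ?thesis
    by (metis Int_absorb2 subsetI)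
qed

text \<open>The factors \<open>1 / t\<^sup>n\<close> make this family closed under differentiation.\<close>

definition flat_exp :: "nat \<Rightarrow> real \<Rightarrow> real" where
  "flat_exp n t = (if t > 0 then inverse t ^ n * exp (- inverse t) else 0)"

text \<open>Put \<open>s = inverse t\<close>: as \<open>t\<close> decreases to 0, \<open>s\<close>
  tends to infinity and the exponential beats the power in \<open>s ^ n / exp s\<close>. On the left
  the function is 0.\<close>

lemma flat_exp_tendsto_0: "(flat_exp n \<longlongrightarrow> 0) (at 0)"
proof -
  have "((\<lambda>t. inverse t ^ n / exp (inverse t)) \<longlongrightarrow> 0) (at_right (0::real))"
    by (rule filterlim_compose[OF tendsto_power_div_exp_0 filterlim_inverse_at_top_right])
  then have "(flat_exp n \<longlongrightarrow> 0) (at_right 0)"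
    by (rule Lim_transform_eventually)
       (auto simp: eventually_at_filter flat_exp_def exp_minus divide_inverse)
  moreover have "(flat_exp n \<longlongrightarrow> 0) (at_left 0)"
    by (rule tendsto_eventually) (auto simp: eventually_at_filter flat_exp_def)
  ultimately show ?thesis
    by (simp add: filterlim_split_at)
qed

text \<open>For \<open>t > 0\<close> and \<open>s = inverse t\<close>, differentiating
  \<open>s ^ n * exp (- s)\<close> multiplies by \<open>- s ^ 2\<close> through the inner derivative
  and yields two members of the family again. The point 0 is the only delicate one.\<close>

lemma flat_exp_has_derivative:
  "(flat_exp n has_real_derivative (flat_exp (n + 2) t - n * flat_exp (n + 1) t)) (at t)"
proof -
  consider "t > 0" | "t < 0" | "t = 0" by linarith
  then show ?thesis
  proof cases
    case 1
    have "((\<lambda>t. inverse t ^ n * exp (- inverse t)) has_real_derivative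
        (flat_exp (n + 2) t - n * flat_exp (n + 1) t)) (at t)"
    proof -
      have "((\<lambda>t. inverse t ^ n) has_real_derivative - n * inverse t ^ (n + 1)) (at t)"
        using DERIV_power[OF DERIV_inverse[of t], of n] 1 by (cases n) (auto simp: algebra_simps)
      moreover have "((\<lambda>t. exp (- inverse t)) has_real_derivative exp (- inverse t) * inverse t ^ 2) (at t)"
        using DERIV_chain2[OF DERIV_exp DERIV_minus[OF DERIV_inverse[of t]]] 1
        by (simp add: numeral_2_eq_2)
      ultimately show ?thesis
        by (rule DERIV_cong[OF DERIV_mult]) (use 1 in \<open>simp add: flat_exp_def algebra_simps power2_eq_square\<close>)
    qed
    then show ?thesis
      using 1 by (elim has_field_derivative_transform_within[where d = t])
        (auto simp: flat_exp_def dist_real_def)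
  next
    case 2
    have "((\<lambda>t. 0) has_real_derivative (flat_exp (n + 2) t - n * flat_exp (n + 1) t)) (at t)"
      using 2 by (simp add: flat_exp_def)
    then show ?thesis
      using 2 by (elim has_field_derivative_transform_within[where d = "- t"])
        (auto simp: flat_exp_def dist_real_def)
  next
    case 3
    \<comment> \<open>Since \<open>flat_exp n 0 = 0\<close>, the difference quotient at 0 is itself
      \<open>flat_exp (n + 1) h\<close> for nonzero \<open>h\<close>.\<close>
    have "((\<lambda>h. (flat_exp n (0 + h) - flat_exp n 0) / h) \<longlongrightarrow> 0) (at 0)"
      by (rule Lim_transform_eventually[OF flat_exp_tendsto_0[of "n + 1"]])
         (auto simp: eventually_at_filter flat_exp_def field_simps)
    then have "(flat_exp n has_real_derivative 0) (at 0)"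
      by (simp add: DERIV_def)
    then show ?thesis
      using 3 by (simp add: flat_exp_def)
  qed
qed

lemma smooth_flat_exp: "smooth_on UNIV (flat_exp n)"
proof -
  have "k_smooth_on k UNIV (flat_exp n)" for k
  proof (induction k arbitrary: n)
    case 0
    then show ?case
      by (auto intro!: continuous_at_imp_continuous_on DERIV_isCont flat_exp_has_derivative)
  next
    case (Suc k)
    show ?case
    proof (rule k_smooth_on_SucI)
      show "(flat_exp n has_derivative
          (\<lambda>v. (flat_exp (n + 2) x + (- real n) * flat_exp (n + 1) x) * v)) (at x)" for x
        using flat_exp_has_derivative[of n x] by (simp add: has_field_derivative_def)
      show "k_smooth_on k UNIV (\<lambda>x. (flat_exp (n + 2) x + (- real n) * flat_exp (n + 1) x) * v)" for v
        by (rule k_smooth_on_bounded_linear[OF bounded_linear_mult_left open_UNIV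
              k_smooth_on_add[OF open_UNIV Suc.IH
              k_smooth_on_bounded_linear[OF bounded_linear_mult_right open_UNIV Suc.IH]]])
    qed simp
  qed
  then show ?thesis by (simp add: smooth_on_def)
qed

lemma smooth_bump_exists:
  fixes a :: "'e::real_inner"
  assumes "r > 0"
  shows "\<exists>\<beta> :: 'e \<Rightarrow> real. smooth_on UNIV \<beta> \<and> \<beta> a = 1 \<and> (\<forall>x. x \<notin> cball a r \<longrightarrow> \<beta> x = 0)"
proof -
  \<comment> \<open>The squared norm keeps the argument smooth at the centre \<open>a\<close>; the
    argument is at most 0 outside the ball, where \<open>flat_exp\<close> vanishes. The constant
    factor, finite because \<open>r > 0\<close>, normalises the value at \<open>a\<close> to
    1.\<close>
  define \<beta> where "\<beta> x = flat_exp 0 (r\<^sup>2 + - ((x - a) \<bullet> (x - a))) * inverse (flat_exp 0 (r\<^sup>2))" for x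
  have 1: "\<beta> a = 1"
    using assms by (simp add: \<beta>_def flat_exp_def)
  have 2: "\<beta> x = 0" if "x \<notin> cball a r" for x
  proof -
    have "r < norm (x - a)"
      using that by (simp add: dist_norm norm_minus_commute)
    then have "r\<^sup>2 \<le> (norm (x - a))\<^sup>2"
      using assms by (intro power_mono) auto
    then show ?thesis
      by (simp add: \<beta>_def flat_exp_def power2_norm_eq_inner)
  qed
  have shift: "k_smooth_on k UNIV (\<lambda>x. x - a)" for k
    using k_smooth_on_add[OF open_UNIV k_smooth_on_id[OF open_UNIV] k_smooth_on_const[OF open_UNIV, of k "- a"]]
    by simp
  have arg: "k_smooth_on k UNIV (\<lambda>x. r\<^sup>2 + - ((x - a) \<bullet> (x - a)))" for k
    by (rule k_smooth_on_add[OF open_UNIV k_smooth_on_const[OF open_UNIV]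
          k_smooth_on_bounded_linear[OF bounded_linear_minus[OF bounded_linear_ident] open_UNIV
            k_smooth_on_bounded_bilinear[OF bounded_bilinear_inner open_UNIV shift shift]]])
  have "span {1::real} = UNIV"
    by (auto simp: span_singleton)
  have "k_smooth_on k UNIV (\<lambda>x. flat_exp 0 (r\<^sup>2 + - ((x - a) \<bullet> (x - a))))" for k
    by (rule k_smooth_on_compose[where B = "{1}" and T = UNIV])
       (use \<open>span {1::real} = UNIV\<close> arg smooth_flat_exp in \<open>auto simp: smooth_on_def\<close>)
  then have 3: "smooth_on UNIV \<beta>"
    unfolding smooth_on_def \<beta>_def
    by (intro allI k_smooth_on_bounded_linear[OF bounded_linear_mult_left open_UNIV])
  show ?thesis
    using 1 2 3 by (intro exI conjI allI impI)
qed

subsection \<open>Changes of charts\<close>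

abbreviation transition_derivative ::
    "('a, 'e::real_normed_vector) chart \<Rightarrow> ('a, 'e) chart \<Rightarrow> 'a \<Rightarrow> 'e \<Rightarrow> 'e" where
  "transition_derivative c d p \<equiv> frechet_derivative (transition c d) (at (chart_map c p))"

lemma chart_inv_chart:
  "smooth_atlas A \<Longrightarrow> c \<in> A \<Longrightarrow> p \<in> chart_dom c \<Longrightarrow> chart_inv c (chart_map c p) = p"
  by (simp add: smooth_atlas_def inv_into_f_f)

lemma transition_chart:
  "smooth_atlas A \<Longrightarrow> c \<in> A \<Longrightarrow> p \<in> chart_dom c \<Longrightarrow> transition c d (chart_map c p) = chart_map d p"
  by (simp add: transition_def chart_inv_chart)

lemma chart_image_Int:
  "smooth_atlas A \<Longrightarrow> c \<in> A \<Longrightarrow> S \<subseteq> chart_dom c \<Longrightarrow> T \<subseteq> chart_dom c \<Longrightarrow>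
    chart_map c ` (S \<inter> T) = chart_map c ` S \<inter> chart_map c ` T"
  by (simp add: smooth_atlas_def inj_on_image_Int[of "chart_map c" "chart_dom c"])

lemma open_chart_overlap:
  "smooth_atlas A \<Longrightarrow> c \<in> A \<Longrightarrow> d \<in> A \<Longrightarrow> open (chart_map c ` (chart_dom c \<inter> chart_dom d))"
  by (simp add: smooth_atlas_def)

lemma smooth_on_transition:
  "smooth_atlas A \<Longrightarrow> c \<in> A \<Longrightarrow> d \<in> A \<Longrightarrow>
    smooth_on (chart_map c ` (chart_dom c \<inter> chart_dom d)) (transition c d)"
  by (simp add: smooth_atlas_def)

lemma transition_has_derivative:
  assumes "smooth_atlas A" "c \<in> A" "d \<in> A" "p \<in> chart_dom c" "p \<in> chart_dom d"
  shows "(transition c d has_derivative transition_derivative c d p) (at (chart_map c p))"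
  using smooth_on_has_derivative[OF smooth_on_transition[OF assms(1-3)]] assms(4,5) by simp

text \<open>Values of \<open>chart_inv\<close> outside the chart image are arbitrary, so a local
  representative agrees with a usable formula only on an open set around \<open>x\<close>. The rule
  differentiates the formula in its place.\<close>

lemma frechet_derivative_eqI:
  assumes "(g has_derivative D) (at x)" "open S" "x \<in> S" "\<And>y. y \<in> S \<Longrightarrow> f y = g y"
  shows "frechet_derivative f (at x) = D"
  using frechet_derivative_cong_open[OF assms(2-4)] frechet_derivative_at[OF assms(1)] by simp

lemma transition_derivative_self:
  assumes "smooth_atlas A" "c \<in> A" "p \<in> chart_dom c"
  shows "transition_derivative c c p = (\<lambda>w. w)"
  by (rule frechet_derivative_eqI[OF has_derivative_ident open_chart_overlap[OF assms(1,2,2)]])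
     (use assms in \<open>auto simp: transition_chart[OF assms(1,2)]\<close>)

text \<open>The cocycle rule. It is the chain rule for the factorisation of
  \<open>transition c e\<close> through \<open>d\<close>, which holds on the image \<open>?S\<close>
  of the triple overlap.\<close>

lemma transition_derivative_compose:
  assumes A: "smooth_atlas A" and "c \<in> A" "d \<in> A" "e \<in> A"
    and "p \<in> chart_dom c" "p \<in> chart_dom d" "p \<in> chart_dom e"
  shows "transition_derivative d e p (transition_derivative c d p w) = transition_derivative c e p w"
proof -
  let ?S = "chart_map c ` (chart_dom c \<inter> chart_dom d) \<inter> chart_map c ` (chart_dom c \<inter> chart_dom e)"
  have "frechet_derivative (transition c e) (at (chart_map c p)) =
      (\<lambda>w. transition_derivative d e p (transition_derivative c d p w))"
  proof (rule frechet_derivative_eqI[where S = ?S])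
    show "((\<lambda>x. transition d e (transition c d x)) has_derivative
        (\<lambda>w. transition_derivative d e p (transition_derivative c d p w))) (at (chart_map c p))"
      using has_derivative_compose[OF transition_has_derivative[of A c d p]] assms
        transition_has_derivative[of A d e p] by (simp add: transition_chart[OF A])
    show "transition c e y = transition d e (transition c d y)" if "y \<in> ?S" for y
      using that assms
      by (auto simp: chart_image_Int[OF A, symmetric] transition_chart[OF A])
    show "open ?S"
      by (intro open_Int open_chart_overlap[OF A] assms)
  qed (use assms in auto)
  then show ?thesis by simp
qed

lemma open_chart_dom:
  "smooth_atlas A \<Longrightarrow> c \<in> A \<Longrightarrow> open (chart_map c ` chart_dom c)"
  by (simp add: smooth_atlas_def)

lemma openin_points: "smooth_atlas A \<Longrightarrow> openin (manifold_topology A) (points A)"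
proof -
  assume A: "smooth_atlas A"
  have "points A \<inter> chart_dom c = chart_dom c" if "c \<in> A" for c
    using that by (auto simp: points_def)
  then show ?thesis
    by (simp add: openin_manifold_topology[OF A] open_chart_dom[OF A])
qed

subsection \<open>Tangent vectors and tangent maps\<close>

text \<open>For \<open>p\<close> in the domain of \<open>c\<close>, this inverts the map that sends
  a tangent vector at \<open>p\<close> to its component in \<open>c\<close>; it thus identifies the
  model space with the tangent space. The value 0 elsewhere follows the convention of
  \<open>tangent_space\<close>.\<close>

definition vector_of_component ::
    "('a, 'e::real_normed_vector) chart set \<Rightarrow> ('a, 'e) chart \<Rightarrow> 'a \<Rightarrow> 'e \<Rightarrow> ('a, 'e) chart \<Rightarrow> 'e" where
  "vector_of_component A c p w =
     (\<lambda>d. if d \<in> A \<and> p \<in> chart_dom d then transition_derivative c d p w else 0)"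

lemma tangent_space_component:
  "\<xi> \<in> tangent_space A p \<Longrightarrow> c \<in> A \<Longrightarrow> d \<in> A \<Longrightarrow> p \<in> chart_dom c \<Longrightarrow> p \<in> chart_dom d \<Longrightarrow>
    \<xi> d = transition_derivative c d p (\<xi> c)"
  unfolding tangent_space_def by blast

lemma tangent_space_zero:
  "\<xi> \<in> tangent_space A p \<Longrightarrow> \<not> (c \<in> A \<and> p \<in> chart_dom c) \<Longrightarrow> \<xi> c = 0"
  unfolding tangent_space_def by blast

lemma tangent_space_eqI:
  assumes "\<xi> \<in> tangent_space A p" "\<eta> \<in> tangent_space A p"
    and "\<And>d. d \<in> A \<Longrightarrow> p \<in> chart_dom d \<Longrightarrow> \<xi> d = \<eta> d"
  shows "\<xi> = \<eta>"
proof
  fix d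
  show "\<xi> d = \<eta> d"
    using assms(3) tangent_space_zero[OF assms(1), of d] tangent_space_zero[OF assms(2), of d]
    by (cases "d \<in> A \<and> p \<in> chart_dom d") simp_all
qed

lemma vector_of_component_tangent:
  assumes "smooth_atlas A" "c \<in> A" "p \<in> chart_dom c"
  shows "vector_of_component A c p w \<in> tangent_space A p"
  unfolding tangent_space_def mem_Collect_eq vector_of_component_def
  by (simp add: transition_derivative_compose[OF assms(1,2) _ _ assms(3)])

lemma vector_of_component_self:
  "smooth_atlas A \<Longrightarrow> c \<in> A \<Longrightarrow> p \<in> chart_dom c \<Longrightarrow> vector_of_component A c p w c = w"
  by (simp add: vector_of_component_def transition_derivative_self)

lemma vector_of_component_unique:
  assumes "\<xi> \<in> tangent_space A p" "c \<in> A" "p \<in> chart_dom c"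
  shows "vector_of_component A c p (\<xi> c) = \<xi>"
proof
  fix d
  show "vector_of_component A c p (\<xi> c) d = \<xi> d"
  proof (cases "d \<in> A \<and> p \<in> chart_dom d")
    case True
    then show ?thesis
      using tangent_space_component[OF assms(1,2) _ assms(3), of d]
      by (simp add: vector_of_component_def)
  next
    case False
    then show ?thesis
      by (simp only: vector_of_component_def if_False tangent_space_zero[OF assms(1) False])
  qed
qed

lemma smooth_map_onD:
  assumes "smooth_map_on A W B f" "c \<in> A" "d \<in> B"
  shows "open (chart_map c ` {p \<in> W \<inter> chart_dom c. f p \<in> chart_dom d})"
    and "smooth_on (chart_map c ` {p \<in> W \<inter> chart_dom c. f p \<in> chart_dom d})
           (chart_map d \<circ> f \<circ> chart_inv c)"
  using assms by (simp_all add: smooth_map_on_def Let_def)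

text \<open>Near \<open>p\<close> the representative in \<open>c'\<close>, \<open>d'\<close> is the
  one in \<open>c\<close>, \<open>d\<close> between two transitions; the chain rule does the rest.
  This independence of charts is what makes the description in \<open>tangent_map\<close>
  consistent.\<close>

lemma local_representative_derivative:
  assumes A: "smooth_atlas A" and B: "smooth_atlas B" and f: "smooth_map_on A W B f"
    and p: "p \<in> W" and c: "c \<in> A" "c' \<in> A" "p \<in> chart_dom c" "p \<in> chart_dom c'"
    and d: "d \<in> B" "d' \<in> B" "f p \<in> chart_dom d" "f p \<in> chart_dom d'"
  shows "frechet_derivative (chart_map d' \<circ> f \<circ> chart_inv c') (at (chart_map c' p)) w =
    transition_derivative d d' (f p) (frechet_derivative (chart_map d \<circ> f \<circ> chart_inv c)
      (at (chart_map c p)) (transition_derivative c' c p w))"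
proof -
  let ?R = "chart_map d \<circ> f \<circ> chart_inv c"
  let ?S = "chart_map c' ` {p \<in> W \<inter> chart_dom c'. f p \<in> chart_dom d} \<inter>
      chart_map c' ` {p \<in> W \<inter> chart_dom c'. f p \<in> chart_dom d'} \<inter>
      chart_map c' ` (chart_dom c' \<inter> chart_dom c)"
  have "frechet_derivative (chart_map d' \<circ> f \<circ> chart_inv c') (at (chart_map c' p)) =
      (\<lambda>w. transition_derivative d d' (f p) (frechet_derivative ?R
      (at (chart_map c p)) (transition_derivative c' c p w)))"
  proof (rule frechet_derivative_eqI[where S = ?S])
    have "(?R has_derivative frechet_derivative ?R (at (chart_map c p))) (at (chart_map c p))"
      by (rule smooth_on_has_derivative[OF smooth_map_onD(2)[OF f c(1) d(1)]]) (use p c d in auto)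
    then have R: "(?R has_derivative frechet_derivative ?R (at (chart_map c p)))
        (at (transition c' c (chart_map c' p)))"
      by (simp add: transition_chart[OF A c(2,4)])
    have T: "(transition d d' has_derivative transition_derivative d d' (f p))
        (at (?R (transition c' c (chart_map c' p))))"
      using transition_has_derivative[OF B d]
      by (simp add: transition_chart[OF A c(2,4)] chart_inv_chart[OF A c(1,3)])
    show "((\<lambda>x. transition d d' (?R (transition c' c x))) has_derivative
        (\<lambda>w. transition_derivative d d' (f p) (frechet_derivative ?R
        (at (chart_map c p)) (transition_derivative c' c p w)))) (at (chart_map c' p))"
      by (rule has_derivative_compose[OF has_derivative_compose[OF
              transition_has_derivative[OF A c(2,1,4,3)] R] T])
    show "open ?S"
      by (intro open_Int smooth_map_onD(1)[OF f] open_chart_overlap[OF A] c d)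
    show "chart_map c' p \<in> ?S"
      using p c d by blast
    show "(chart_map d' \<circ> f \<circ> chart_inv c') y = transition d d' (?R (transition c' c y))"
      if "y \<in> ?S" for y
    proof -
      have "y \<in> chart_map c' ` ({p \<in> W \<inter> chart_dom c'. f p \<in> chart_dom d} \<inter>
          {p \<in> W \<inter> chart_dom c'. f p \<in> chart_dom d'} \<inter> (chart_dom c' \<inter> chart_dom c))"
        using that by (subst chart_image_Int[OF A c(2)], blast, blast, subst chart_image_Int[OF A c(2)])
          auto
      then obtain q where "y = chart_map c' q" "q \<in> chart_dom c'" "q \<in> chart_dom c"
          "f q \<in> chart_dom d" "f q \<in> chart_dom d'"
        by blast
      then show ?thesis
        using c d by (simp add: transition_chart[OF A] transition_chart[OF B] chart_inv_chart[OF A])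
    qed
  qed
  then show ?thesis by simp
qed

text \<open>Shows that the description in \<open>tangent_map\<close> has exactly one candidate, so
  that its components can be computed in any pair of charts.\<close>

lemma tangent_map_component:
  assumes A: "smooth_atlas A" and B: "smooth_atlas B" and f: "smooth_map_on A W B f"
    and W: "W \<subseteq> points A" and p: "p \<in> W" and u: "u \<in> tangent_space A p"
  shows "snd (tangent_map A B f (p, u)) \<in> tangent_space B (f p)"
    and "\<And>c d. c \<in> A \<Longrightarrow> d \<in> B \<Longrightarrow> p \<in> chart_dom c \<Longrightarrow> f p \<in> chart_dom d \<Longrightarrow>
      snd (tangent_map A B f (p, u)) d =
        frechet_derivative (chart_map d \<circ> f \<circ> chart_inv c) (at (chart_map c p)) (u c)"
proof -
  let ?P = "\<lambda>\<eta>. \<eta> \<in> tangent_space B (f p) \<and>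
      (\<forall>c\<in>A. \<forall>d\<in>B. p \<in> chart_dom c \<and> f p \<in> chart_dom d \<longrightarrow>
        \<eta> d = frechet_derivative (chart_map d \<circ> f \<circ> chart_inv c) (at (chart_map c p)) (u c))"
  obtain c0 where c0: "c0 \<in> A" "p \<in> chart_dom c0"
    using p W by (auto simp: points_def)
  have "f p \<in> points B"
    using f p by (auto simp: smooth_map_on_def)
  then obtain d0 where d0: "d0 \<in> B" "f p \<in> chart_dom d0"
    by (auto simp: points_def)
  let ?w = "frechet_derivative (chart_map d0 \<circ> f \<circ> chart_inv c0) (at (chart_map c0 p)) (u c0)"
  \<comment> \<open>The candidate is built from the single pair \<open>c0\<close>,
    \<open>d0\<close>; the change of charts carries its defining property to all other
    pairs.\<close>
  have ex: "?P (vector_of_component B d0 (f p) ?w)"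
  proof (intro conjI ballI impI)
    show "vector_of_component B d0 (f p) ?w \<in> tangent_space B (f p)"
      by (rule vector_of_component_tangent[OF B d0])
    fix c d assume cd: "c \<in> A" "d \<in> B" "p \<in> chart_dom c \<and> f p \<in> chart_dom d"
    have "u c0 = transition_derivative c c0 p (u c)"
      using tangent_space_component[OF u] cd c0 by blast
    then show "vector_of_component B d0 (f p) ?w d =
        frechet_derivative (chart_map d \<circ> f \<circ> chart_inv c) (at (chart_map c p)) (u c)"
      using local_representative_derivative[OF A B f p, of c0 c d0 d "u c"] cd c0 d0
      by (simp add: vector_of_component_def)
  qed
  have unique: "\<eta> = \<eta>'" if "?P \<eta>" "?P \<eta>'" for \<eta> \<eta>'
    using that c0 by (intro tangent_space_eqI[of \<eta> B "f p" \<eta>']) auto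
  have "?P (THE \<eta>. ?P \<eta>)"
    by (rule theI[of ?P, OF ex]) (rule unique[OF _ ex])
  moreover have "snd (tangent_map A B f (p, u)) = (THE \<eta>. ?P \<eta>)"
    by (simp add: tangent_map_def)
  ultimately show "snd (tangent_map A B f (p, u)) \<in> tangent_space B (f p)"
    and "\<And>c d. c \<in> A \<Longrightarrow> d \<in> B \<Longrightarrow> p \<in> chart_dom c \<Longrightarrow> f p \<in> chart_dom d \<Longrightarrow>
      snd (tangent_map A B f (p, u)) d =
        frechet_derivative (chart_map d \<circ> f \<circ> chart_inv c) (at (chart_map c p)) (u c)"
    by simp_all
qed

subsection \<open>The tangent bundle as a manifold\<close>

lemma tangent_chart_dom:
  "chart_dom (tangent_chart A c) = {v \<in> tangent_bundle A. fst v \<in> chart_dom c}"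
  by (simp add: tangent_chart_def)

lemma tangent_chart_map [simp]:
  "chart_map (tangent_chart A c) v = (chart_map c (fst v), snd v c)"
  by (simp add: tangent_chart_def)

lemma tangent_bundle_iff:
  "v \<in> tangent_bundle A \<longleftrightarrow> fst v \<in> points A \<and> snd v \<in> tangent_space A (fst v)"
  by (cases v) (simp add: tangent_bundle_def)

lemma inj_on_tangent_chart:
  assumes "smooth_atlas A" "c \<in> A"
  shows "inj_on (chart_map (tangent_chart A c)) (chart_dom (tangent_chart A c))"
proof (rule inj_onI, simp only: tangent_chart_dom tangent_chart_map mem_Collect_eq prod.inject, elim conjE)
  fix v v'
  assume v: "v \<in> tangent_bundle A" "fst v \<in> chart_dom c" "v' \<in> tangent_bundle A" "fst v' \<in> chart_dom c"
    and eq: "chart_map c (fst v) = chart_map c (fst v')" "snd v c = snd v' c"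
  have fst: "fst v = fst v'"
    using chart_inv_chart[OF assms v(2)] chart_inv_chart[OF assms v(4)] eq(1) by metis
  have "snd v = vector_of_component A c (fst v) (snd v c)"
    using vector_of_component_unique[OF _ assms(2) v(2)] v(1) by (simp only: tangent_bundle_iff)
  also have "\<dots> = vector_of_component A c (fst v') (snd v' c)"
    by (simp only: fst eq(2))
  also have "\<dots> = snd v'"
    using vector_of_component_unique[OF _ assms(2) v(4)] v(3) by (simp only: tangent_bundle_iff)
  finally have "snd v = snd v'" .
  with fst show "v = v'"
    by (rule prod_eqI)
qed

lemma vector_of_component_bundle:
  assumes "smooth_atlas A" "c \<in> A" "p \<in> chart_dom c"
  shows "(p, vector_of_component A c p w) \<in> tangent_bundle A"
  using assms(2,3) vector_of_component_tangent[OF assms]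
  by (auto simp: tangent_bundle_iff points_def)

lemma tangent_chart_image:
  fixes A :: "('a, 'e::real_normed_vector) chart set"
  assumes "smooth_atlas A" "c \<in> A" "P \<subseteq> chart_dom c"
  shows "chart_map (tangent_chart A c) ` {v \<in> tangent_bundle A. fst v \<in> P} = (chart_map c ` P) \<times> UNIV"
proof (intro subset_antisym subsetI)
  fix y :: "'e \<times> 'e" assume "y \<in> (chart_map c ` P) \<times> UNIV"
  then obtain p w where y: "y = (chart_map c p, w)" "p \<in> P"
    by auto
  then have p: "p \<in> chart_dom c"
    using assms(3) by blast
  have "y = chart_map (tangent_chart A c) (p, vector_of_component A c p w)"
    by (simp add: y vector_of_component_self[OF assms(1,2) p])
  then show "y \<in> chart_map (tangent_chart A c) ` {v \<in> tangent_bundle A. fst v \<in> P}"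
    using vector_of_component_bundle[OF assms(1,2) p, of w] y(2) by (intro image_eqI) auto
qed auto

lemma tangent_chart_inv:
  assumes "smooth_atlas A" "c \<in> A" "p \<in> chart_dom c"
  shows "chart_inv (tangent_chart A c) (chart_map c p, w) = (p, vector_of_component A c p w)"
proof -
  have "inv_into (chart_dom (tangent_chart A c)) (chart_map (tangent_chart A c))
      (chart_map (tangent_chart A c) (p, vector_of_component A c p w)) = (p, vector_of_component A c p w)"
    using vector_of_component_bundle[OF assms] assms(3)
    by (intro inv_into_f_f inj_on_tangent_chart[OF assms(1,2)]) (simp add: tangent_chart_dom)
  then show ?thesis
    by (simp add: vector_of_component_self[OF assms])
qed

lemma tangent_transition:
  assumes "smooth_atlas A" "c \<in> A" "d \<in> A" "p \<in> chart_dom c" "p \<in> chart_dom d"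
  shows "transition (tangent_chart A c) (tangent_chart A d) (chart_map c p, w) =
    (chart_map d p, transition_derivative c d p w)"
  using assms(3,5) by (simp add: transition_def[of "tangent_chart A c"] tangent_chart_inv[OF assms(1,2,4)]
      vector_of_component_def)

text \<open>\<open>smooth_on_derivative\<close> concerns a fixed direction, while here the direction
  is a variable as well. Expanding it in coordinates and using linearity leaves finitely many fixed
  directions with smooth coefficients.\<close>

lemma smooth_on_directional_derivative:
  fixes f :: "'e::real_inner \<Rightarrow> 'f::real_normed_vector"
  assumes "finite B" "span B = (UNIV :: 'e set)" "open S" "smooth_on S f"
  shows "smooth_on (S \<times> UNIV) (\<lambda>y. frechet_derivative f (at (fst y)) (snd y))"
proof -
  obtain C and g :: "'e \<Rightarrow> 'e" where C: "finite C" "\<forall>x. (\<Sum>b\<in>C. (x \<bullet> g b) *\<^sub>R b) = x"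
    using finite_dim_coordinates[OF assms(1,2)] by (elim exE conjE) (rule that)
  have S: "open (S \<times> (UNIV :: 'e set))"
    by (intro open_Times assms(3) open_UNIV)
  have "smooth_on (S \<times> UNIV) (\<lambda>y. \<Sum>b\<in>C. (snd y \<bullet> g b) *\<^sub>R frechet_derivative f (at (fst y)) b)"
  proof (rule smooth_on_sum[OF S])
    fix b
    have 1: "smooth_on (S \<times> (UNIV :: 'e set)) (\<lambda>y. snd y \<bullet> g b)"
      by (rule smooth_on_bounded_linear[OF bounded_linear_inner_left S
            smooth_on_bounded_linear[OF bounded_linear_snd S smooth_on_id[OF S]]])
    have 2: "smooth_on (S \<times> (UNIV :: 'e set)) (\<lambda>y. frechet_derivative f (at (fst y)) b)"
      by (rule smooth_on_compose[OF assms(1,2) S _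
            smooth_on_bounded_linear[OF bounded_linear_fst S smooth_on_id[OF S]]
            smooth_on_derivative[OF assms(4), of b]]) auto
    show "smooth_on (S \<times> UNIV) (\<lambda>y. (snd y \<bullet> g b) *\<^sub>R frechet_derivative f (at (fst y)) b)"
      using smooth_on_bounded_bilinear[OF bounded_bilinear_scaleR S 1 2] .
  qed
  then show ?thesis
  proof (rule smooth_on_cong[OF S])
    fix y :: "'e \<times> 'e" assume "y \<in> S \<times> UNIV"
    then have "fst y \<in> S" by auto
    then have lin: "linear (frechet_derivative f (at (fst y)))"
      by (rule has_derivative_linear[OF smooth_on_has_derivative[OF assms(4)]])
    from linear_sum[OF lin, of "\<lambda>b. (snd y \<bullet> g b) *\<^sub>R b" C]
    show "(\<Sum>b\<in>C. (snd y \<bullet> g b) *\<^sub>R frechet_derivative f (at (fst y)) b) =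
        frechet_derivative f (at (fst y)) (snd y)"
      by (simp add: C(2) linear_scale[OF lin])
  qed
qed

lemma tangent_chart_overlap_image:
  assumes "smooth_atlas A" "c \<in> A"
  shows "chart_map (tangent_chart A c) ` (chart_dom (tangent_chart A c) \<inter> chart_dom (tangent_chart A d)) =
    chart_map c ` (chart_dom c \<inter> chart_dom d) \<times> UNIV"
proof -
  have "chart_dom (tangent_chart A c) \<inter> chart_dom (tangent_chart A d) =
      {v \<in> tangent_bundle A. fst v \<in> chart_dom c \<inter> chart_dom d}"
    by (auto simp: tangent_chart_dom)
  then show ?thesis
    using tangent_chart_image[OF assms, of "chart_dom c \<inter> chart_dom d"] by simp
qed

text \<open>A transition of TM is a transition of M together with its derivative in the fibre
  variable, so its smoothness is joint smoothness in point and direction.\<close>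

lemma smooth_atlas_tangent:
  fixes A :: "('a, 'e::real_inner) chart set" and B :: "'e set"
  assumes fin: "finite B" "span B = (UNIV :: 'e set)" and A: "smooth_atlas A"
  shows "smooth_atlas (tangent_atlas A)"
proof -
  have overlap: "open (chart_map (tangent_chart A c) ` (chart_dom (tangent_chart A c) \<inter> chart_dom (tangent_chart A d)))"
    if "c \<in> A" "d \<in> A" for c d
    unfolding tangent_chart_overlap_image[OF A that(1)]
    by (intro open_Times open_chart_overlap[OF A] that open_UNIV)
  have "smooth_on (chart_map (tangent_chart A c) ` (chart_dom (tangent_chart A c) \<inter> chart_dom (tangent_chart A d)))
      (transition (tangent_chart A c) (tangent_chart A d))" if cd: "c \<in> A" "d \<in> A" for c d
  proof -
    let ?S = "chart_map c ` (chart_dom c \<inter> chart_dom d)"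
    have S: "open ?S"
      by (rule open_chart_overlap[OF A cd])
    have SU: "open (?S \<times> (UNIV :: 'e set))"
      by (intro open_Times S open_UNIV)
    have 1: "smooth_on (?S \<times> (UNIV :: 'e set)) (\<lambda>y. transition c d (fst y))"
      by (rule smooth_on_compose[OF fin SU _
            smooth_on_bounded_linear[OF bounded_linear_fst SU smooth_on_id[OF SU]]
            smooth_on_transition[OF A cd]]) auto
    have "smooth_on (?S \<times> UNIV) (\<lambda>y. (transition c d (fst y), frechet_derivative (transition c d) (at (fst y)) (snd y)))"
      by (rule smooth_on_Pair[OF SU 1
            smooth_on_directional_derivative[OF fin S smooth_on_transition[OF A cd]]])
    then have "smooth_on (?S \<times> UNIV) (transition (tangent_chart A c) (tangent_chart A d))"
    proof (rule smooth_on_cong[OF SU])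
      fix y :: "'e \<times> 'e" assume "y \<in> ?S \<times> UNIV"
      then obtain p w where "y = (chart_map c p, w)" "p \<in> chart_dom c" "p \<in> chart_dom d"
        by auto
      then show "(transition c d (fst y), frechet_derivative (transition c d) (at (fst y)) (snd y)) =
          transition (tangent_chart A c) (tangent_chart A d) y"
        using tangent_transition[OF A cd] transition_chart[OF A cd(1)] by simp
    qed
    then show ?thesis
      by (simp only: tangent_chart_overlap_image[OF A cd(1)])
  qed
  moreover have "open (chart_map (tangent_chart A c) ` chart_dom (tangent_chart A c))" if "c \<in> A" for c
    using overlap[OF that that] by simp
  ultimately show ?thesis
    unfolding smooth_atlas_def tangent_atlas_def
    using overlap inj_on_tangent_chart[OF A] by blast
qed

lemma smooth_map_on_fst:
  fixes A :: "('a, 'e::real_inner) chart set" and B :: "'e set"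
  assumes fin: "finite B" "span B = (UNIV :: 'e set)" and A: "smooth_atlas A"
  shows "smooth_map_on (tangent_atlas A) (tangent_bundle A) A fst"
  unfolding smooth_map_on_def Let_def
proof (intro conjI ballI)
  show "openin (manifold_topology (tangent_atlas A)) (tangent_bundle A)"
    using openin_points[OF smooth_atlas_tangent[OF assms]] by (simp only: points_tangent_atlas)
  show "fst ` tangent_bundle A \<subseteq> points A"
    by (auto simp: tangent_bundle_iff)
  fix c' d assume "c' \<in> tangent_atlas A" and d: "d \<in> A"
  then obtain c where c: "c \<in> A" "c' = tangent_chart A c"
    by (auto simp: tangent_atlas_def)
  let ?S = "chart_map c ` (chart_dom c \<inter> chart_dom d)"
  have dom: "{v \<in> tangent_bundle A \<inter> chart_dom c'. fst v \<in> chart_dom d} =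
      {v \<in> tangent_bundle A. fst v \<in> chart_dom c \<inter> chart_dom d}"
    by (auto simp: c(2) tangent_chart_dom)
  have D: "chart_map c' ` {v \<in> tangent_bundle A \<inter> chart_dom c'. fst v \<in> chart_dom d} = ?S \<times> UNIV"
    unfolding dom unfolding c(2) by (rule tangent_chart_image[OF A c(1)]) simp
  have SU: "open (?S \<times> (UNIV :: 'e set))"
    by (intro open_Times open_chart_overlap[OF A c(1) d] open_UNIV)
  then show "open (chart_map c' ` {v \<in> tangent_bundle A \<inter> chart_dom c'. fst v \<in> chart_dom d})"
    by (simp only: D)
  have "smooth_on (?S \<times> (UNIV :: 'e set)) (\<lambda>y. transition c d (fst y))"
    by (rule smooth_on_compose[OF fin SU _
          smooth_on_bounded_linear[OF bounded_linear_fst SU smooth_on_id[OF SU]]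
          smooth_on_transition[OF A c(1) d]]) auto
  then have "smooth_on (?S \<times> UNIV) (chart_map d \<circ> fst \<circ> chart_inv c')"
  proof (rule smooth_on_cong[OF SU])
    fix y :: "'e \<times> 'e" assume "y \<in> ?S \<times> UNIV"
    then obtain p w where "y = (chart_map c p, w)" "p \<in> chart_dom c" "p \<in> chart_dom d"
      by auto
    then show "transition c d (fst y) = (chart_map d \<circ> fst \<circ> chart_inv c') y"
      by (simp add: transition_chart[OF A c(1)] tangent_chart_inv[OF A c(1)] c(2))
  qed
  then show "smooth_on (chart_map c' ` {v \<in> tangent_bundle A \<inter> chart_dom c'. fst v \<in> chart_dom d})
      (chart_map d \<circ> fst \<circ> chart_inv c')"
    by (simp only: D)
qed

subsection \<open>Vertical vectors\<close>

text \<open>Between the tangent chart of \<open>d\<close> and \<open>d\<close> itself, the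
  projection of TM is the linear map \<open>fst\<close>, which is its own derivative.\<close>

lemma tangent_map_fst:
  fixes A :: "('a, 'e::real_inner) chart set" and B :: "'e set"
  assumes fin: "finite B" "span B = (UNIV :: 'e set)" and A: "smooth_atlas A"
    and v: "v \<in> tangent_bundle A" and \<zeta>: "\<zeta> \<in> tangent_space (tangent_atlas A) v"
  shows "snd (tangent_map (tangent_atlas A) A fst (v, \<zeta>)) \<in> tangent_space A (fst v)"
    and "\<And>d. d \<in> A \<Longrightarrow> fst v \<in> chart_dom d \<Longrightarrow>
      snd (tangent_map (tangent_atlas A) A fst (v, \<zeta>)) d = fst (\<zeta> (tangent_chart A d))"
proof -
  have sub: "tangent_bundle A \<subseteq> points (tangent_atlas A)"
    by (simp only: points_tangent_atlas)
  note comp = tangent_map_component[OF smooth_atlas_tangent[OF fin A] A smooth_map_on_fst[OF fin A] sub v \<zeta>]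
  show "snd (tangent_map (tangent_atlas A) A fst (v, \<zeta>)) \<in> tangent_space A (fst v)"
    by (rule comp(1))
  fix d assume d: "d \<in> A" "fst v \<in> chart_dom d"
  let ?S = "chart_map d ` chart_dom d \<times> (UNIV :: 'e set)"
  have "frechet_derivative (chart_map d \<circ> fst \<circ> chart_inv (tangent_chart A d))
      (at (chart_map (tangent_chart A d) v)) = fst"
  proof (rule frechet_derivative_eqI[where S = ?S])
    show "(fst has_derivative fst) (at (chart_map (tangent_chart A d) v))"
      by (rule bounded_linear.has_derivative[OF bounded_linear_fst has_derivative_ident])
    show "open ?S"
      by (intro open_Times open_chart_dom[OF A d(1)] open_UNIV)
    show "chart_map (tangent_chart A d) v \<in> ?S"
      using d by simp
    fix y assume "y \<in> ?S"
    then obtain q w where "y = (chart_map d q, w)" "q \<in> chart_dom d"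
      by auto
    then show "(chart_map d \<circ> fst \<circ> chart_inv (tangent_chart A d)) y = fst y"
      by (simp add: tangent_chart_inv[OF A d(1)])
  qed
  moreover have "tangent_chart A d \<in> tangent_atlas A" "v \<in> chart_dom (tangent_chart A d)"
    using d v by (auto simp: tangent_atlas_def tangent_chart_dom)
  ultimately show "snd (tangent_map (tangent_atlas A) A fst (v, \<zeta>)) d = fst (\<zeta> (tangent_chart A d))"
    using comp(2)[of "tangent_chart A d" d] d by simp
qed

text \<open>Turns the kernel condition into linear conditions on components; fibre computations with
  vertical vectors go through this form.\<close>

lemma vertical_bundle_iff:
  fixes A :: "('a, 'e::real_inner) chart set" and B :: "'e set"
  assumes fin: "finite B" "span B = (UNIV :: 'e set)" and A: "smooth_atlas A"
    and v: "v \<in> tangent_bundle A"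
  shows "\<zeta> \<in> vertical_bundle A `` {v} \<longleftrightarrow> \<zeta> \<in> tangent_space (tangent_atlas A) v \<and>
    (\<forall>d\<in>A. fst v \<in> chart_dom d \<longrightarrow> fst (\<zeta> (tangent_chart A d)) = 0)"
proof -
  have mem: "(v, \<zeta>) \<in> tangent_bundle (tangent_atlas A) \<longleftrightarrow> \<zeta> \<in> tangent_space (tangent_atlas A) v"
    using v by (simp add: tangent_bundle_iff[of "(v, \<zeta>)"] points_tangent_atlas)
  have "snd (tangent_map (tangent_atlas A) A fst (v, \<zeta>)) = 0 \<longleftrightarrow>
      (\<forall>d\<in>A. fst v \<in> chart_dom d \<longrightarrow> fst (\<zeta> (tangent_chart A d)) = 0)"
    if \<zeta>: "\<zeta> \<in> tangent_space (tangent_atlas A) v"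
  proof
    assume 0: "snd (tangent_map (tangent_atlas A) A fst (v, \<zeta>)) = 0"
    show "\<forall>d\<in>A. fst v \<in> chart_dom d \<longrightarrow> fst (\<zeta> (tangent_chart A d)) = 0"
      using tangent_map_fst(2)[OF assms \<zeta>] unfolding 0 by simp
  next
    assume 0: "\<forall>d\<in>A. fst v \<in> chart_dom d \<longrightarrow> fst (\<zeta> (tangent_chart A d)) = 0"
    show "snd (tangent_map (tangent_atlas A) A fst (v, \<zeta>)) = 0"
      by (rule tangent_space_eqI[OF tangent_map_fst(1)[OF assms \<zeta>] subspace_0[OF subspace_tangent_space[OF A]]])
        (use 0 tangent_map_fst(2)[OF assms \<zeta>] in simp)
  qed
  then show ?thesis
    unfolding vertical_bundle_def using mem by auto
qed

section \<open>The canonical identification of a vertical space with a tangent space of M\<close>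

lemma vertical_lift_component:
  assumes "v \<in> tangent_bundle A" "c \<in> A" "fst v \<in> chart_dom c"
  shows "snd (vertical_lift A v w) (tangent_chart A c) = (0, w c)"
proof -
  have "((\<lambda>t. (chart_map c (fst v), snd v c + t *\<^sub>R w c)) has_vector_derivative (0, w c)) (at 0)"
    by (auto intro!: derivative_eq_intros has_vector_derivative_Pair)
  then have "vector_derivative (\<lambda>t. (chart_map c (fst v), snd v c + t *\<^sub>R w c)) (at 0) = (0, w c)"
    by (rule vector_derivative_at)
  moreover have "chart_map (tangent_chart A c) \<circ> (\<lambda>t. (fst v, snd v + t *\<^sub>R w)) =
      (\<lambda>t. (chart_map c (fst v), snd v c + t *\<^sub>R w c))"
    by (auto simp: fun_eq_iff)
  moreover have "tangent_chart A c \<in> tangent_atlas A" "v \<in> chart_dom (tangent_chart A c)"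
    using assms by (auto simp: tangent_atlas_def tangent_chart_dom)
  ultimately show ?thesis
    by (simp add: vertical_lift_def velocity_def)
qed

lemma vertical_lift_zero:
  "\<not> (c' \<in> tangent_atlas A \<and> v \<in> chart_dom c') \<Longrightarrow> snd (vertical_lift A v w) c' = 0"
  by (auto simp: vertical_lift_def velocity_def)

lemma fst_vertical_lift: "fst (vertical_lift A v w) = v"
  by (simp add: vertical_lift_def velocity_def)

text \<open>
  The second derivative of the transition map, which enters the derivative of a tangent
  transition, is not seen by vertical vectors.
\<close>

lemma tangent_transition_derivative_vertical:
  fixes A :: "('a, 'e::real_inner) chart set" and B :: "'e set"
  assumes fin: "finite B" "span B = (UNIV :: 'e set)" and A: "smooth_atlas A"
    and v: "v \<in> tangent_bundle A" and c: "c \<in> A" "fst v \<in> chart_dom c" and d: "d \<in> A" "fst v \<in> chart_dom d"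
  shows "transition_derivative (tangent_chart A c) (tangent_chart A d) v (0, w) =
    (0, transition_derivative c d (fst v) w)"
proof -
  let ?T = "transition (tangent_chart A c) (tangent_chart A d)"
  let ?T' = "transition_derivative (tangent_chart A c) (tangent_chart A d) v"
  let ?D = "transition_derivative c d (fst v)"
  \<comment> \<open>A straight line inside the fibre, on which the transition \<open>?T\<close>
    moves only the second component, and does so linearly.\<close>
  let ?l = "\<lambda>t::real. (chart_map c (fst v), snd v c + t *\<^sub>R w)"
  have T: "(?T has_derivative ?T') (at (?l 0))"
    using transition_has_derivative[OF smooth_atlas_tangent[OF fin A],
        of "tangent_chart A c" "tangent_chart A d" v] v c d
    by (simp add: tangent_atlas_def tangent_chart_dom)
  have l: "(?l has_derivative (\<lambda>t. (0, t *\<^sub>R w))) (at 0)"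
    by (auto intro!: derivative_eq_intros)
  have lin: "bounded_linear ?D"
    by (rule has_derivative_bounded_linear[OF transition_has_derivative[OF A c(1) d(1) c(2) d(2)]])
  have "((\<lambda>t. (chart_map d (fst v), ?D (snd v c + t *\<^sub>R w))) has_derivative
      (\<lambda>t. (0, ?D (t *\<^sub>R w)))) (at 0)"
    by (rule has_derivative_Pair[OF has_derivative_const bounded_linear.has_derivative[OF lin]])
       (auto intro!: derivative_eq_intros)
  then have "((\<lambda>t. ?T (?l t)) has_derivative (\<lambda>t. (0, ?D (t *\<^sub>R w)))) (at 0)"
    by (simp only: tangent_transition[OF A c(1) d(1) c(2) d(2)])
  \<comment> \<open>The curve has been differentiated directly and by the chain rule; comparing the
    two results at 1 gives the claim.\<close>
  from has_derivative_unique[OF this has_derivative_compose[OF l T]]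
  have "(0, ?D (1 *\<^sub>R w)) = ?T' (0, 1 *\<^sub>R w)"
    by (rule fun_cong)
  then show ?thesis by simp
qed

text \<open>Justifies the description in \<open>canonical_K\<close>. The second components of a
  vertical vector transform by the derivatives of the transitions of M, hence form a tangent vector
  \<open>w\<close> of M, and its lift returns the given vector.\<close>

lemma vertical_vector_is_lift:
  fixes A :: "('a, 'e::real_inner) chart set" and B :: "'e set"
  assumes fin: "finite B" "span B = (UNIV :: 'e set)" and A: "smooth_atlas A"
    and v: "v \<in> tangent_bundle A" and \<zeta>: "\<zeta> \<in> vertical_bundle A `` {v}"
  shows "\<exists>!w. w \<in> tangent_space A (fst v) \<and> vertical_lift A v w = (v, \<zeta>)"
proof (rule ex_ex1I)
  note vert = \<zeta>[unfolded vertical_bundle_iff[OF fin A v]]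
  define w where "w c = (if c \<in> A \<and> fst v \<in> chart_dom c then snd (\<zeta> (tangent_chart A c)) else 0)" for c
  have comp: "\<zeta> (tangent_chart A c) = (0, w c)" if "c \<in> A" "fst v \<in> chart_dom c" for c
    using vert that by (simp add: w_def prod_eq_iff)
  have "w \<in> tangent_space A (fst v)"
    unfolding tangent_space_def mem_Collect_eq
  proof (intro conjI ballI allI impI)
    fix c d assume cd: "c \<in> A" "d \<in> A" "fst v \<in> chart_dom c \<and> fst v \<in> chart_dom d"
    have "\<zeta> (tangent_chart A d) =
        transition_derivative (tangent_chart A c) (tangent_chart A d) v (\<zeta> (tangent_chart A c))"
      by (rule tangent_space_component[OF conjunct1[OF vert]])
         (use cd v in \<open>auto simp: tangent_atlas_def tangent_chart_dom\<close>)
    then show "w d = transition_derivative c d (fst v) (w c)"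
      using cd by (simp add: comp tangent_transition_derivative_vertical[OF fin A v] del: tangent_chart_map)
  qed (simp only: w_def if_False)
  moreover have "vertical_lift A v w = (v, \<zeta>)"
  proof (rule prod_eqI)
    show "snd (vertical_lift A v w) = snd (v, \<zeta>)"
    proof
      fix c'
      show "snd (vertical_lift A v w) c' = snd (v, \<zeta>) c'"
      proof (cases "c' \<in> tangent_atlas A \<and> v \<in> chart_dom c'")
        case True
        then obtain c where "c' = tangent_chart A c" "c \<in> A" "fst v \<in> chart_dom c"
          by (auto simp: tangent_atlas_def tangent_chart_dom)
        then show ?thesis
          by (simp add: vertical_lift_component[OF v] comp)
      next
        case False
        then show ?thesis
          using vertical_lift_zero[OF False] tangent_space_zero[OF conjunct1[OF vert] False] by simp
      qed
    qed
  qed (simp add: fst_vertical_lift)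
  ultimately show "\<exists>w. w \<in> tangent_space A (fst v) \<and> vertical_lift A v w = (v, \<zeta>)"
    by blast
next
  fix w w'
  assume w: "w \<in> tangent_space A (fst v) \<and> vertical_lift A v w = (v, \<zeta>)"
    and w': "w' \<in> tangent_space A (fst v) \<and> vertical_lift A v w' = (v, \<zeta>)"
  show "w = w'"
  proof (rule tangent_space_eqI[OF conjunct1[OF w] conjunct1[OF w']])
    fix d assume d: "d \<in> A" "fst v \<in> chart_dom d"
    have "(0, w d) = snd (vertical_lift A v w) (tangent_chart A d)"
      by (rule vertical_lift_component[OF v d, symmetric])
    also have "\<dots> = snd (vertical_lift A v w') (tangent_chart A d)"
      by (simp only: conjunct2[OF w] conjunct2[OF w'])
    also have "\<dots> = (0, w' d)"
      by (rule vertical_lift_component[OF v d])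
    finally show "w d = w' d" by simp
  qed
qed

text \<open>On vertical vectors at \<open>v\<close> the lift undoes
  \<open>canonical_K\<close>.\<close>

lemma canonical_K_inject:
  fixes A :: "('a, 'e::real_inner) chart set" and B :: "'e set"
  assumes fin: "finite B" "span B = (UNIV :: 'e set)" and A: "smooth_atlas A"
    and v: "v \<in> tangent_bundle A" and \<zeta>: "\<zeta> \<in> vertical_bundle A `` {v}" "\<zeta>' \<in> vertical_bundle A `` {v}"
    and eq: "canonical_K A (v, \<zeta>) = canonical_K A (v, \<zeta>')"
  shows "\<zeta> = \<zeta>'"
proof -
  have lift: "vertical_lift A v (snd (canonical_K A (v, \<eta>))) = (v, \<eta>)" if "\<eta> \<in> vertical_bundle A `` {v}" for \<eta>
    unfolding canonical_K_def Let_def fst_conv snd_conv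
    by (rule conjunct2[OF theI'[OF vertical_vector_is_lift[OF fin A v that]]])
  have "(v, \<zeta>) = vertical_lift A v (snd (canonical_K A (v, \<zeta>)))"
    by (rule lift[OF \<zeta>(1), symmetric])
  also have "\<dots> = (v, \<zeta>')"
    unfolding eq by (rule lift[OF \<zeta>(2)])
  finally show ?thesis by simp
qed

text \<open>A vector field is a section of the projection, so its tangent map followed by the
  tangent map of the projection fixes \<open>u\<close>; the second claim is this fact in chart
  components.\<close>

lemma vector_field_derivative:
  assumes A: "smooth_atlas A" and TA: "smooth_atlas (tangent_atlas A)"
    and V: "V \<in> vector_fields A" and p: "p \<in> points A" and u: "u \<in> tangent_space A p"
  shows "snd (tangent_map A (tangent_atlas A) V (p, u)) \<in> tangent_space (tangent_atlas A) (V p)"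
    and "\<And>d. d \<in> A \<Longrightarrow> p \<in> chart_dom d \<Longrightarrow>
      fst (snd (tangent_map A (tangent_atlas A) V (p, u)) (tangent_chart A d)) = u d"
proof -
  have sm: "smooth_map_on A (points A) (tangent_atlas A) V" and sec: "\<And>q. q \<in> points A \<Longrightarrow> fst (V q) = q"
    using V by (auto simp: vector_fields_def)
  have Vq: "V q \<in> tangent_bundle A" if "q \<in> points A" for q
    using sm that points_tangent_atlas[of A] by (auto simp: smooth_map_on_def)
  note comp = tangent_map_component[OF A TA sm order_refl p u]
  show "snd (tangent_map A (tangent_atlas A) V (p, u)) \<in> tangent_space (tangent_atlas A) (V p)"
    by (rule comp(1))
  fix d assume d: "d \<in> A" "p \<in> chart_dom d"
  have td: "tangent_chart A d \<in> tangent_atlas A" "V p \<in> chart_dom (tangent_chart A d)"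
    using d Vq[OF p] sec[OF p] by (auto simp: tangent_atlas_def tangent_chart_dom)
  let ?R = "chart_map (tangent_chart A d) \<circ> V \<circ> chart_inv d"
  let ?S = "chart_map d ` {q \<in> points A \<inter> chart_dom d. V q \<in> chart_dom (tangent_chart A d)}"
  have pS: "chart_map d p \<in> ?S"
    using p d td by blast
  have "(?R has_derivative frechet_derivative ?R (at (chart_map d p))) (at (chart_map d p))"
    by (rule smooth_on_has_derivative[OF smooth_map_onD(2)[OF sm d(1) td(1)] pS])
  then have 1: "((\<lambda>y. fst (?R y)) has_derivative (\<lambda>w. fst (frechet_derivative ?R (at (chart_map d p)) w)))
      (at (chart_map d p))"
    by (rule bounded_linear.has_derivative[OF bounded_linear_fst])
  \<comment> \<open>The section property in the chart: the base part of the representative is the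
    identity on \<open>?S\<close>.\<close>
  have "frechet_derivative (\<lambda>y. y) (at (chart_map d p)) = (\<lambda>w. fst (frechet_derivative ?R (at (chart_map d p)) w))"
  proof (rule frechet_derivative_eqI[OF 1 smooth_map_onD(1)[OF sm d(1) td(1)] pS])
    fix y assume "y \<in> ?S"
    then show "y = fst (?R y)"
      using chart_inv_chart[OF A d(1)] sec by auto
  qed
  then have "fst (frechet_derivative ?R (at (chart_map d p)) (u d)) = u d"
    using frechet_derivative_at[OF has_derivative_ident, of "chart_map d p"] by (metis (no_types))
  then show "fst (snd (tangent_map A (tangent_atlas A) V (p, u)) (tangent_chart A d)) = u d"
    by (simp only: comp(2)[OF d(1) td(1) d(2) td(2)])
qed

subsection \<open>Vector fields through a given tangent vector\<close>

lemma topspace_manifold_topology: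
  assumes "smooth_atlas A"
  shows "topspace (manifold_topology A) = points A"
proof
  show "topspace (manifold_topology A) \<subseteq> points A"
    using openin_manifold_topology[OF assms] openin_topspace by blast
  show "points A \<subseteq> topspace (manifold_topology A)"
    by (rule openin_subset[OF openin_points[OF assms]])
qed

lemma continuous_map_chart_inv:
  assumes A: "smooth_atlas A" and c: "c \<in> A"
  shows "continuous_map (top_of_set (chart_map c ` chart_dom c)) (manifold_topology A) (chart_inv c)"
  unfolding continuous_map_def topspace_manifold_topology[OF A] topspace_euclidean_subtopology
proof (intro conjI allI impI)
  show "chart_inv c \<in> chart_map c ` chart_dom c \<rightarrow> points A"
    using c by (auto simp: chart_inv_chart[OF A c] points_def)
  fix W assume W: "openin (manifold_topology A) W"
  have "{x \<in> chart_map c ` chart_dom c. chart_inv c x \<in> W} = chart_map c ` (W \<inter> chart_dom c)"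
    by (auto simp: chart_inv_chart[OF A c])
  moreover have "open (chart_map c ` (W \<inter> chart_dom c))"
    using W c by (simp add: openin_manifold_topology[OF A])
  ultimately show "openin (top_of_set (chart_map c ` chart_dom c))
      {x \<in> chart_map c ` chart_dom c. chart_inv c x \<in> W}"
    by (metis (no_types, lifting) openin_open_eq[OF open_chart_dom[OF A c]] image_mono inf_le2)
qed

text \<open>The image of the ball is compact, hence closed because M is Hausdorff. On a line with
  two origins, a ball around one origin in its chart is not closed, as the other origin lies in its
  closure.\<close>

lemma open_compl_chart_cball:
  fixes A :: "('a, 'e::real_inner) chart set" and B :: "'e set"
  assumes fin: "finite B" "span B = (UNIV :: 'e set)" and A: "smooth_atlas A"
    and haus: "Hausdorff_space (manifold_topology A)"
    and c: "c \<in> A" and r: "cball a r \<subseteq> chart_map c ` chart_dom c"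
  shows "openin (manifold_topology A) (points A - chart_inv c ` cball a r)"
proof -
  have "compactin (top_of_set (chart_map c ` chart_dom c)) (cball a r)"
    using compact_cball_finite_dim[OF fin] r by (simp add: compactin_subtopology)
  then have "compactin (manifold_topology A) (chart_inv c ` cball a r)"
    by (rule image_compactin[OF _ continuous_map_chart_inv[OF A c]])
  then have "closedin (manifold_topology A) (chart_inv c ` cball a r)"
    by (rule compactin_imp_closedin[OF haus])
  then show ?thesis
    by (simp add: closedin_def topspace_manifold_topology[OF A])
qed

lemma vector_field_through:
  fixes A :: "('a, 'e::real_inner) chart set"
  assumes M: "smooth_manifold A" and v: "v \<in> tangent_bundle A"
  shows "\<exists>V\<in>vector_fields A. V (fst v) = v"
proof -
  obtain B :: "'e set" where fin: "finite B" "span B = UNIV"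
    using M by (auto simp: smooth_manifold_def)
  have A: "smooth_atlas A" and haus: "Hausdorff_space (manifold_topology A)"
    using M by (simp_all add: smooth_manifold_def)
  have p: "fst v \<in> points A" and \<xi>: "snd v \<in> tangent_space A (fst v)"
    using v by (simp_all add: tangent_bundle_iff)
  obtain c0 where c0: "c0 \<in> A" "fst v \<in> chart_dom c0"
    using p by (auto simp: points_def)
  define a where "a = chart_map c0 (fst v)"
  define w where "w = snd v c0"
  have "a \<in> chart_map c0 ` chart_dom c0"
    using c0 by (simp add: a_def)
  \<comment> \<open>With the ball inside the chart image, every point of M lies in
    \<open>chart_dom c0\<close> or outside the compact set \<open>K\<close> below, so two local
    checks of smoothness cover M.\<close>
  then obtain r where r: "r > 0" "cball a r \<subseteq> chart_map c0 ` chart_dom c0"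
    using open_chart_dom[OF A c0(1)] open_contains_cball by blast
  obtain \<beta> :: "'e \<Rightarrow> real" where \<beta>: "smooth_on UNIV \<beta>" "\<beta> a = 1" "\<And>x. x \<notin> cball a r \<Longrightarrow> \<beta> x = 0"
    using smooth_bump_exists[OF r(1)] by blast
  define K where "K = chart_inv c0 ` cball a r"
  have K: "openin (manifold_topology A) (points A - K)"
    unfolding K_def by (rule open_compl_chart_cball[OF fin A haus c0(1) r(2)])
  have K_dom: "K \<subseteq> chart_dom c0"
    unfolding K_def using r(2) chart_inv_chart[OF A c0(1)] by auto
  define X where "X q = (if q \<in> chart_dom c0 then \<beta> (chart_map c0 q) *\<^sub>R vector_of_component A c0 q w else 0)" for q
  define V where "V = (\<lambda>q\<in>points A. (q, X q))"
  have X_space: "X q \<in> tangent_space A q" for q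
    using vector_of_component_tangent[OF A c0(1)] subspace_tangent_space[OF A, of q]
    by (auto simp: X_def intro: subspace_scale subspace_0)
  have X_outside: "X q = 0" if "q \<notin> K" for q
  proof (cases "q \<in> chart_dom c0")
    case True
    then have "chart_map c0 q \<notin> cball a r"
      using that chart_inv_chart[OF A c0(1) True] unfolding K_def by (metis imageI)
    then show ?thesis
      by (simp add: X_def \<beta>(3))
  qed (simp add: X_def)
  have "V (fst v) = v"
    using p c0 vector_of_component_unique[OF \<xi> c0] by (simp add: V_def X_def a_def[symmetric] \<beta>(2) w_def)
  moreover have "smooth_map_on A (points A) (tangent_atlas A) V"
    unfolding smooth_map_on_def Let_def
  proof (intro conjI ballI)
    show "openin (manifold_topology A) (points A)"
      by (rule openin_points[OF A])
    show "V ` points A \<subseteq> points (tangent_atlas A)"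
      using X_space by (auto simp: points_tangent_atlas tangent_bundle_iff V_def)
    fix c d' assume c: "c \<in> A" and "d' \<in> tangent_atlas A"
    then obtain d where d: "d \<in> A" "d' = tangent_chart A d"
      by (auto simp: tangent_atlas_def)
    have "{q \<in> points A \<inter> chart_dom c. V q \<in> chart_dom d'} = chart_dom c \<inter> chart_dom d"
      using X_space c by (auto simp: V_def d(2) tangent_chart_dom tangent_bundle_iff points_def)
    then have D: "chart_map c ` {q \<in> points A \<inter> chart_dom c. V q \<in> chart_dom d'} =
        chart_map c ` (chart_dom c \<inter> chart_dom d)" (is "_ = ?S")
      by simp
    have S: "open ?S"
      by (rule open_chart_overlap[OF A c d(1)])
    then show "open (chart_map c ` {q \<in> points A \<inter> chart_dom c. V q \<in> chart_dom d'})"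
      by (simp only: D)
    let ?R = "chart_map d' \<circ> V \<circ> chart_inv c"
    have R: "?R (chart_map c q) = (chart_map d q, X q d)" if "q \<in> chart_dom c" for q
      using that c by (auto simp: chart_inv_chart[OF A c] V_def d(2) points_def)
    \<comment> \<open>On \<open>?S1\<close> the formula in the chart \<open>c0\<close> applies; on
      \<open>?S2\<close> the field is the zero section.\<close>
    let ?S1 = "?S \<inter> chart_map c ` (chart_dom c \<inter> chart_dom c0)"
    let ?S2 = "?S \<inter> chart_map c ` ((points A - K) \<inter> chart_dom c)"
    have S1: "open ?S1"
      by (intro open_Int S open_chart_overlap[OF A c c0(1)])
    have S2: "open ?S2"
      using K c S by (simp add: openin_manifold_topology[OF A] open_Int)
    have "smooth_on ?S1 ?R"
    proof -
      have tr: "smooth_on ?S1 (transition c c0)"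
        by (rule smooth_on_subset[OF smooth_on_transition[OF A c c0(1)]]) auto
      have S1_eq: "?S1 = chart_map c ` (chart_dom c \<inter> chart_dom d \<inter> (chart_dom c \<inter> chart_dom c0))"
        by (rule chart_image_Int[OF A c, symmetric]) auto
      have "transition c c0 ` ?S1 \<subseteq> chart_map c0 ` (chart_dom c0 \<inter> chart_dom d)"
        unfolding S1_eq by (auto simp: transition_chart[OF A c])
      \<comment> \<open>The direction \<open>w\<close> is constant, so this is a fixed directional
        derivative of \<open>transition c0 d\<close>, evaluated at the moving point
        \<open>transition c c0 y\<close>.\<close>
      then have 1: "smooth_on ?S1 (\<lambda>y. frechet_derivative (transition c0 d) (at (transition c c0 y)) w)"
        by (rule smooth_on_compose[OF fin S1 _ tr smooth_on_derivative[OF smooth_on_transition[OF A c0(1) d(1)]]])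
      have 2: "smooth_on ?S1 (\<lambda>y. \<beta> (transition c c0 y))"
        by (rule smooth_on_compose[OF fin S1 subset_UNIV tr \<beta>(1)])
      have 3: "smooth_on ?S1 (transition c d)"
        by (rule smooth_on_subset[OF smooth_on_transition[OF A c d(1)]]) auto
      show ?thesis
      proof (rule smooth_on_cong[OF S1 smooth_on_Pair[OF S1 3
              smooth_on_bounded_bilinear[OF bounded_bilinear_scaleR S1 2 1]]])
        fix y assume "y \<in> ?S1"
        then obtain q where q: "y = chart_map c q" "q \<in> chart_dom c" "q \<in> chart_dom d" "q \<in> chart_dom c0"
          unfolding S1_eq by blast
        show "(transition c d y, \<beta> (transition c c0 y) *\<^sub>R
            frechet_derivative (transition c0 d) (at (transition c c0 y)) w) = ?R y"
          unfolding q(1) R[OF q(2)] using q(2-4) d(1)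
          by (simp add: transition_chart[OF A c] X_def vector_of_component_def)
      qed
    qed
    moreover have "smooth_on ?S2 ?R"
    proof (rule smooth_on_cong[OF S2 smooth_on_Pair[OF S2
            smooth_on_subset[OF smooth_on_transition[OF A c d(1)] Int_lower1] smooth_on_const[OF S2, of 0]]])
      fix y assume "y \<in> ?S2"
      then have "y \<in> chart_map c ` (chart_dom c \<inter> chart_dom d \<inter> ((points A - K) \<inter> chart_dom c))"
        by (subst chart_image_Int[OF A c]) auto
      then obtain q where q: "y = chart_map c q" "q \<in> chart_dom c" "q \<notin> K"
        by blast
      show "(transition c d y, 0) = ?R y"
        unfolding q(1) R[OF q(2)] by (simp add: transition_chart[OF A c q(2)] X_outside[OF q(3)])
    qed
    ultimately have "smooth_on (?S1 \<union> ?S2) ?R"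
      by (rule smooth_on_Un[OF S1 S2])
    moreover have "?S1 \<union> ?S2 = ?S"
      using K_dom c by (auto simp: points_def)
    ultimately show "smooth_on (chart_map c ` {q \<in> points A \<inter> chart_dom c. V q \<in> chart_dom d'}) ?R"
      by (simp only: D)
  qed
  ultimately show ?thesis
    by (intro bexI[of _ V]) (auto simp: vector_fields_def V_def)
qed

subsection \<open>Connections are determined by their covariant derivatives\<close>

lemma subspace_vertical_bundle:
  fixes A :: "('a, 'e::real_inner) chart set" and B :: "'e set"
  assumes fin: "finite B" "span B = (UNIV :: 'e set)" and A: "smooth_atlas A"
    and v: "v \<in> tangent_bundle A"
  shows "subspace (vertical_bundle A `` {v})"
proof -
  have T: "subspace (tangent_space (tangent_atlas A) v)"
    by (rule subspace_tangent_space[OF smooth_atlas_tangent[OF fin A]])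
  show ?thesis
    by (rule subspaceI; unfold vertical_bundle_iff[OF fin A v])
       (simp_all add: subspace_0[OF T] subspace_add[OF T] subspace_scale[OF T])
qed

text \<open>Linearity of the fibre comes from the local frame, whose span at \<open>v\<close> is the
  fibre.\<close>

lemma subspace_connection:
  assumes "connection A H" "v \<in> tangent_bundle A"
  shows "subspace (H `` {v})"
proof -
  have "smooth_subbundle (tangent_atlas A) H"
    using assms(1) by (simp only: connection_def)
  from bspec[OF conjunct2[OF this[unfolded smooth_subbundle_def points_tangent_atlas]] assms(2)]
  show ?thesis
  proof (elim exE conjE)
    fix W k and X :: "nat \<Rightarrow> _"
    assume "v \<in> W" and "\<forall>q\<in>W. (\<forall>i<k. fst (X i q) = q) \<and>
        inj_on (\<lambda>i. snd (X i q)) {..<k} \<and> independent ((\<lambda>i. snd (X i q)) ` {..<k}) \<and>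
        span ((\<lambda>i. snd (X i q)) ` {..<k}) = H `` {q}"
    then have "span ((\<lambda>i. snd (X i v)) ` {..<k}) = H `` {v}"
      by simp
    then show ?thesis
      using subspace_span[of "(\<lambda>i. snd (X i v)) ` {..<k}"] by simp
  qed
qed

lemma connection_fibre_subset:
  "connection A H \<Longrightarrow> h \<in> H `` {v} \<Longrightarrow> v \<in> tangent_bundle A \<and> h \<in> tangent_space (tangent_atlas A) v"
  unfolding connection_def smooth_subbundle_def Image_singleton_iff
  using tangent_bundle_iff[of "(v, h)" "tangent_atlas A"] points_tangent_atlas[of A] by auto

text \<open>Two candidates differ by a vector that is horizontal and, as a difference of vertical
  remainders, also vertical, hence by 0. Any splitting found by hand is therefore the one that the
  description selects.\<close>

lemma horizontal_projection_eq:
  fixes A :: "('a, 'e::real_inner) chart set" and B :: "'e set"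
  assumes fin: "finite B" "span B = (UNIV :: 'e set)" and A: "smooth_atlas A"
    and H: "connection A H" and v: "v \<in> tangent_bundle A"
    and h: "h \<in> H `` {v}" "\<zeta> - h \<in> vertical_bundle A `` {v}"
  shows "horizontal_projection A H (v, \<zeta>) = (v, h)"
proof -
  have unique: "h' = h" if h': "h' \<in> H `` {v}" "\<zeta> - h' \<in> vertical_bundle A `` {v}" for h'
  proof -
    have "h' - h \<in> H `` {v}"
      by (rule subspace_diff[OF subspace_connection[OF H v] h'(1) h(1)])
    moreover have "(\<zeta> - h) - (\<zeta> - h') \<in> vertical_bundle A `` {v}"
      by (rule subspace_diff[OF subspace_vertical_bundle[OF fin A v] h(2) h'(2)])
    ultimately have "h' - h \<in> H `` {v} \<inter> vertical_bundle A `` {v}"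
      by simp
    then have "h' - h \<in> {0}"
      using H v unfolding connection_def by blast
    then show ?thesis by simp
  qed
  have "(THE h. h \<in> H `` {v} \<and> \<zeta> - h \<in> vertical_bundle A `` {v}) = h"
    by (rule the_equality, rule conjI[OF h], elim conjE, rule unique)
  then show ?thesis
    by (simp add: horizontal_projection_def)
qed

lemma connection_subset_of_covariant_derivative_eq:
  fixes M :: "('a, 'e::real_inner) chart set"
  assumes M: "smooth_manifold M" and H: "connection M H" and H': "connection M H'"
    and eq: "covariant_derivative M H = covariant_derivative M H'"
  shows "H \<subseteq> H'"
proof
  fix z assume "z \<in> H"
  obtain v h where z: "z = (v, h)"
    by fastforce
  with \<open>z \<in> H\<close> have h: "h \<in> H `` {v}"
    by simp
  obtain B :: "'e set" where fin: "finite B" "span B = UNIV"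
    using M by (auto simp: smooth_manifold_def)
  have A: "smooth_atlas M"
    using M by (simp add: smooth_manifold_def)
  note TA = smooth_atlas_tangent[OF fin A]
  have v: "v \<in> tangent_bundle M" and hT: "h \<in> tangent_space (tangent_atlas M) v"
    using connection_fibre_subset[OF H h] by simp_all
  define p where "p = fst v"
  have p: "p \<in> points M"
    using v by (simp add: p_def tangent_bundle_iff)
  define u where "u = snd (tangent_map (tangent_atlas M) M fst (v, h))"
  note u = tangent_map_fst[OF fin A v hT, folded u_def p_def]
  obtain U where U: "U \<in> vector_fields M" "U p = (p, u)"
    using vector_field_through[OF M, of "(p, u)"] p u(1) by (auto simp: tangent_bundle_iff)
  obtain V where V: "V \<in> vector_fields M" "V p = v"
    using vector_field_through[OF M v] by (auto simp: p_def)
  define \<zeta> where "\<zeta> = snd (tangent_map M (tangent_atlas M) V (p, u))"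
  have tmap: "tangent_map M (tangent_atlas M) V (p, u) = (v, \<zeta>)"
    by (simp add: \<zeta>_def prod_eq_iff V(2) tangent_map_def)
  note \<zeta> = vector_field_derivative[OF A TA V(1) p u(1), folded \<zeta>_def, unfolded V(2)]
  have vert: "\<zeta> - h \<in> vertical_bundle M `` {v}"
    unfolding vertical_bundle_iff[OF fin A v]
    using subspace_diff[OF subspace_tangent_space[OF TA] \<zeta>(1) hT] \<zeta>(2) u(2) by (simp add: p_def)
  \<comment> \<open>The splitting along \<open>H\<close> is known in advance, with horizontal part
    \<open>h\<close>; the one along \<open>H'\<close> comes from the direct sum condition.\<close>
  have "\<zeta> \<in> {h + w |h w. h \<in> H' `` {v} \<and> w \<in> vertical_bundle M `` {v}}"
    using H' v \<zeta>(1) unfolding connection_def by blast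
  then obtain h' where h': "h' \<in> H' `` {v}" "\<zeta> - h' \<in> vertical_bundle M `` {v}"
    by auto
  \<comment> \<open>Stated for an arbitrary connection \<open>G\<close>, since it is applied to
    both. The operator enters the argument only through its value at \<open>p\<close> on the pair
    \<open>U\<close>, \<open>V\<close>.\<close>
  have K: "covariant_derivative M G (U, V) p = canonical_K M (v, \<zeta> - g)"
    if "connection M G" "g \<in> G `` {v}" "\<zeta> - g \<in> vertical_bundle M `` {v}" for G g
    using U V p horizontal_projection_eq[OF fin A that(1) v that(2,3)]
    by (simp add: covariant_derivative_def connector_def tmap)
  have "canonical_K M (v, \<zeta> - h) = canonical_K M (v, \<zeta> - h')"
    using K[OF H h vert] K[OF H' h'] eq by simp
  then have "\<zeta> - h = \<zeta> - h'"
    by (rule canonical_K_inject[OF fin A v vert h'(2)])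
  then have "h = h'"
    by simp
  then show "z \<in> H'"
    using h'(1) z by simp
qed

theorem theorem4p12:
  fixes M :: "('a, 'e::real_inner) chart set"
  assumes "smooth_manifold M"
  shows "bij_betw (covariant_derivative M) (connections M) (covariant_derivatives M)"
  unfolding bij_betw_def
proof
  show "inj_on (covariant_derivative M) (connections M)"
    using connection_subset_of_covariant_derivative_eq[OF assms]
    by (intro inj_onI subset_antisym) (auto simp: connections_def)
  show "covariant_derivative M ` connections M = covariant_derivatives M"
    by (auto simp: connections_def covariant_derivatives_def)
qed

end
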